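(* Let $q\ge 4$ and let $H_1$ be a hyperplane of $\mathrm{PG}(U_1)$ with $|H_1\cap\mathcal O_1|=q^2-q+1$. Then $H_1\cap\mathcal O_1$ is a $5$-general set of $H_1\cong\mathrm{PG}(6,q)$.
   Context: $q$ is a prime power. Let $U_1\subset\mathbb F_{q^3}^8$ be the set of vectors $(a,b^{q^2},b^{q},c,b,c^{q},c^{q^2},d)$ with $a,d\in\mathbb F_q$, $b,c\in\mathbb F_{q^3}$; it is an $8$-dimensional $\mathbb F_q$-vector space, so $\mathrm{PG}(U_1)\cong\mathrm{PG}(7,q)$. For $(a,b,c,d)\ne 0$ let $P(a,b,c,d)$ be the point of $\mathrm{PG}(U_1)$ spanned by this vector. Let $\mathcal O_1=\{P(1,t,t^{q^2+q},t^{q^2+q+1}) : t\in\mathbb F_{q^3}\}\cup\{P(0,0,0,1)\}$. For integers $r,s$, an $(r,s)$-set of $\mathrm{PG}(n,q)$ is a set $\mathcal X$ of points such that: (i) every $s$-dimensional projective subspace contains at most $r$ points of $\mathcal X$; (ii) $\mathcal X$ spans $\mathrm{PG}(n,q)$; (iii) some $(s+1)$-dimensional projective subspace contains $r+2$ points of $\mathcal X$. A $k$-general set is a $(k-1,k-2)$-set; so a $5$-general set is a $(4,3)$-set. *)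

theory Defs
  imports "HOL-Analysis.Analysis"
begin

text \<open>The field F_{q^3} is a finite field type 'a with CARD('a) = q^3;
  its subfield F_q is the set of fixed points of x \<mapsto> x^q.
  Vectors of F_{q^3}^8 are elements of 'a^8.\<close>

definition Fq :: "nat \<Rightarrow> 'a::{field,finite} set" where
  "Fq q = {x. x ^ q = x}"

definition Pvec :: "nat \<Rightarrow> 'a::{field,finite} \<Rightarrow> 'a \<Rightarrow> 'a \<Rightarrow> 'a \<Rightarrow> 'a ^ 8" where
  "Pvec q a b c d = vector [a, b ^ (q^2), b ^ q, c, b, c ^ q, c ^ (q^2), d]"

definition U1 :: "nat \<Rightarrow> ('a::{field,finite} ^ 8) set" where
  "U1 q = {Pvec q a b c d | a b c d. a \<in> Fq q \<and> d \<in> Fq q}"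

definition fspan :: "nat \<Rightarrow> ('a::{field,finite} ^ 8) set \<Rightarrow> ('a ^ 8) set" where
  "fspan q S = {(\<Sum>v\<in>F. c v *s v) | F c. finite F \<and> F \<subseteq> S \<and> (\<forall>v\<in>F. c v \<in> Fq q)}"

definition fsubspace :: "nat \<Rightarrow> ('a::{field,finite} ^ 8) set \<Rightarrow> bool" where
  "fsubspace q W \<longleftrightarrow> 0 \<in> W \<and> (\<forall>v\<in>W. \<forall>w\<in>W. v + w \<in> W)
     \<and> (\<forall>k\<in>Fq q. \<forall>v\<in>W. k *s v \<in> W)"

definition fdim :: "nat \<Rightarrow> ('a::{field,finite} ^ 8) set \<Rightarrow> nat" where
  "fdim q W = (LEAST n. \<exists>B. finite B \<and> card B = n \<and> B \<subseteq> W \<and> fspan q B = W)"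

definition Ppt :: "nat \<Rightarrow> 'a::{field,finite} \<Rightarrow> 'a \<Rightarrow> 'a \<Rightarrow> 'a \<Rightarrow> ('a ^ 8) set" where
  "Ppt q a b c d = fspan q {Pvec q a b c d}"

definition O1 :: "nat \<Rightarrow> ('a::{field,finite} ^ 8) set set" where
  "O1 q = {Ppt q 1 t (t ^ (q^2 + q)) (t ^ (q^2 + q + 1)) | t. True} \<union> {Ppt q 0 0 0 1}"

text \<open>Points of a projective space PG(V) (V an F_q-subspace) lying in a
  projective subspace PG(W): the point P (a 1-dim subspace) lies in W iff P \<subseteq> W.
  A projective s-dimensional subspace of PG(V) is an (s+1)-dim F_q-subspace of V.\<close>

definition rs_set :: "nat \<Rightarrow> ('a::{field,finite} ^ 8) set \<Rightarrow> nat \<Rightarrow> nat \<Rightarrow> ('a ^ 8) set set \<Rightarrow> bool" where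
  "rs_set q V r s X \<longleftrightarrow>
     (\<forall>W. fsubspace q W \<and> W \<subseteq> V \<and> fdim q W = s + 1 \<longrightarrow> card {P\<in>X. P \<subseteq> W} \<le> r)
   \<and> fspan q (\<Union>X) = V
   \<and> (\<exists>W. fsubspace q W \<and> W \<subseteq> V \<and> fdim q W = s + 2 \<and> card {P\<in>X. P \<subseteq> W} \<ge> r + 2)"

definition k_general :: "nat \<Rightarrow> ('a::{field,finite} ^ 8) set \<Rightarrow> nat \<Rightarrow> ('a ^ 8) set set \<Rightarrow> bool" where
  "k_general q V k X \<longleftrightarrow> rs_set q V (k - 1) (k - 2) X"

end

theory Submission
  imports Defs "HOL-Algebra.Algebraic_Closure_Type" "HOL-Number_Theory.Residues"
begin

hide_const (open) Divisibility.prime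

text \<open>The space U1 is self-dual under the dot product, so a hyperplane is given by a trilinear form F
  evaluated at the points (t, t^q, t^(q^2)) of the projective line over the field with q^3 elements.
  Let Q be the quadratic form whose value at x is the discriminant of the bilinear form F(x, -, -).
  If Q has a zero over that field, moving the zero to infinity turns F into a norm or a trace, which
  has 1, q^2 + 1 or q^2 + q + 1 zeros. So Q is irreducible, with roots th and th' = th^(q^3) in the
  algebraic closure, and F splits as the difference of two conjugate products of linear forms
  in L = x - th and L' = x - th'. In the coordinate u = L / L' the zero set is the set of all roots of
  u^(q^2 - q + 1) = g^(1 - q), and the forms restrict to it as combinations of products of one of
  1, u, u^q with one of 1, u^(-1), u^(-q).

  No three points (1, u, u^q) are collinear; hence a line through two points times a conjugate line
  through two others separates a fifth point from these four, so five points are independent.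
  A form vanishing on the zero set is a polynomial in u of degree at most 2q + 1 with q^2 - q + 1
  roots, so it is a multiple of F, and the points span the hyperplane. Six dependent points exist
  because there are more than q^7 linear combinations of three points when q is at least 5, and by an
  explicit relation between thirteenth roots of unity when q = 4.\<close>

section \<open>Frobenius map, trace and norm\<close>

definition frob :: "nat \<Rightarrow> 'b::monoid_mult \<Rightarrow> 'b" where
  "frob q x = x ^ q"

lemma frob_mult [simp]: "frob q (x * y) = frob q x * frob q (y::'b::comm_monoid_mult)"
  by (simp add: frob_def power_mult_distrib)

lemma frob_one [simp]: "frob q 1 = 1"
  by (simp add: frob_def)

lemma frob_power [simp]: "frob q (x ^ n) = frob q x ^ n"
  by (simp add: frob_def flip: power_mult) (simp add: mult.commute)

lemma frob_inverse [simp]: "frob q (inverse x) = inverse (frob q (x::'b::field))"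
  by (simp add: frob_def power_inverse)

lemma frob_divide [simp]: "frob q (x / y) = frob q x / frob q (y::'b::field)"
  by (simp add: frob_def power_divide)

lemma to_ac_frob [simp]: "to_ac (frob q x) = frob q (to_ac x)"
  by (simp add: frob_def)

text \<open>Pigeonhole with no slack: m * k elements spread over at most m values, with at most k on
  each, turn every bound into an equality. Degree bounds on fibres thereby become exact counts,
  without exhibiting a single preimage.\<close>

lemma fibres_tight:
  assumes "finite A" "finite C" "f ` A \<subseteq> C" "card C \<le> m" "card A = m * k" "k > 0"
    and fib: "\<And>c. c \<in> C \<Longrightarrow> card {x\<in>A. f x = c} \<le> k"
  shows "card C = m" and "\<And>c. c \<in> C \<Longrightarrow> card {x\<in>A. f x = c} = k"
proof -
  have sum: "card A = (\<Sum>c\<in>C. card {x\<in>A. f x = c})"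
    using sum.group[OF assms(1,2,3), of "\<lambda>_. 1::nat"] by simp
  have le: "(\<Sum>c\<in>C. card {x\<in>A. f x = c}) \<le> card C * k"
    using sum_bounded_above[of C "\<lambda>c. card {x\<in>A. f x = c}" k] fib by simp
  show m: "card C = m"
    using sum le assms by (metis le_antisym mult_le_cancel2)
  fix c assume c: "c \<in> C"
  show "card {x\<in>A. f x = c} = k"
  proof (rule ccontr)
    assume "\<not> ?thesis"
    then have "card {x\<in>A. f x = c} < k" using fib[OF c] by simp
    then have "(\<Sum>c\<in>C. card {x\<in>A. f x = c}) < (\<Sum>c\<in>C. k)"
      using fib c assms(2) by (intro sum_strict_mono_ex1) auto
    then show False using sum m assms by simp
  qed
qed

locale cubic_field =
  fixes q :: nat and ty :: "'a::{field,finite} itself"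
  assumes prime_power: "\<exists>p k. prime p \<and> k > 0 \<and> q = p ^ k"
    and card_field: "CARD('a) = q ^ 3"
    and q_ge: "q \<ge> 4"
begin

abbreviation \<sigma> :: "'b::monoid_mult \<Rightarrow> 'b" where "\<sigma> \<equiv> frob q"

text \<open>Additivity of the Frobenius map comes from the freshman's dream, which speaks of powers
  of the characteristic. The characteristic divides the size of the field, and this identifies it
  with the prime below q.\<close>

lemma CHAR_power: "\<exists>k. prime CHAR('a) \<and> q = CHAR('a) ^ k"
proof -
  obtain p k where pk: "prime p" "k > 0" "q = p ^ k" using prime_power by blast
  have pr: "prime CHAR('a)"
    using finite_imp_CHAR_pos[where 'a = 'a] prime_CHAR_semidom by simp
  have "CHAR('a) dvd p ^ (k * 3)"
    using CHAR_dvd_CARD[where 'a = 'a] card_field pk by (simp add: power_mult)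
  then have "CHAR('a) = p" using pr pk(1) prime_dvd_power primes_dvd_imp_eq by blast
  with pk pr show ?thesis by blast
qed

lemma frob_add [simp]: "\<sigma> (x + y) = \<sigma> x + \<sigma> (y::'a)"
proof -
  obtain k where "prime CHAR('a)" "q = CHAR('a) ^ k" using CHAR_power by blast
  then show ?thesis unfolding frob_def using freshmans_dream'[where 'a = 'a] by blast
qed

lemma frob_add_ac [simp]: "\<sigma> (x + y) = \<sigma> x + \<sigma> (y::'a alg_closure)"
proof -
  obtain k where "prime CHAR('a)" "q = CHAR('a) ^ k" using CHAR_power by blast
  then show ?thesis unfolding frob_def
    using freshmans_dream'[where 'a = "'a alg_closure" and m = q and n = k] by simp
qed

lemma frob_zero [simp]: "\<sigma> (0::'b::semidom) = 0"
  using q_ge by (simp add: frob_def)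

lemma frob_eq_0_iff [simp]: "\<sigma> x = 0 \<longleftrightarrow> x = (0::'b::semidom)"
  using q_ge by (simp add: frob_def)

lemma frob_minus [simp]: "\<sigma> (- x) = - \<sigma> (x::'a)"
  by (metis add_eq_0_iff frob_add frob_zero add.right_inverse)

lemma frob_minus_ac [simp]: "\<sigma> (- x) = - \<sigma> (x::'a alg_closure)"
  by (metis add_eq_0_iff frob_add_ac frob_zero add.right_inverse)

lemma frob_diff [simp]: "\<sigma> (x - y) = \<sigma> x - \<sigma> (y::'a)"
  by (metis frob_add frob_minus diff_conv_add_uminus)

lemma frob_diff_ac [simp]: "\<sigma> (x - y) = \<sigma> x - \<sigma> (y::'a alg_closure)"
  by (metis frob_add_ac frob_minus_ac diff_conv_add_uminus)

lemma frob_sum_ac: "\<sigma> (sum f A) = (\<Sum>i\<in>A. \<sigma> (f i :: 'a alg_closure))"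
  by (induction A rule: infinite_finite_induct) auto

lemma frob_eq_iff_ac [simp]: "\<sigma> x = \<sigma> y \<longleftrightarrow> x = (y::'a alg_closure)"
  by (metis frob_diff_ac frob_eq_0_iff right_minus_eq)

text \<open>Multiplication by a nonzero x permutes the nonzero elements, so their product absorbs
  the factor x^(q^3 - 1).\<close>

lemma power_q_cubed: "(x::'a) ^ q ^ 3 = x"
proof (cases "x = 0")
  case True
  then show ?thesis using q_ge by (simp add: power_0_left)
next
  case False
  let ?A = "UNIV - {0::'a}"
  have "bij_betw ((*) x) ?A ?A"
    by (rule bij_betw_byWitness[of _ "\<lambda>y. y / x"]) (use False in auto)
  then have "(\<Prod>y\<in>?A. x * y) = \<Prod>?A" by (rule prod.reindex_bij_betw[where g = "\<lambda>y. y"])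
  then have "x ^ card ?A * \<Prod>?A = \<Prod>?A" by (simp add: prod.distrib)
  then have "x ^ card ?A = 1" by simp
  moreover have "Suc (card ?A) = q ^ 3" using card_field q_ge by (simp add: card_Diff_singleton)
  ultimately show ?thesis by (metis power_Suc mult.right_neutral)
qed

lemma frob_cubed [simp]: "\<sigma> (\<sigma> (\<sigma> x)) = (x::'a)"
  using power_q_cubed[of x] by (simp add: frob_def flip: power_mult) (simp add: power3_eq_cube mult.assoc)

text \<open>Descent criterion for elements of the closure: X^(q^3) - X has at most q^3 roots, and
  the elements of the field already provide that many.\<close>

lemma frob_cubed_ac_iff: "\<sigma> (\<sigma> (\<sigma> x)) = x \<longleftrightarrow> x \<in> range (to_ac :: 'a \<Rightarrow> _)"
proof
  assume x: "\<sigma> (\<sigma> (\<sigma> x)) = x"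
  define p :: "'a alg_closure poly" where "p = Polynomial.monom 1 (q^3) - [:0, 1:]"
  have "1 < q ^ 3" using q_ge by (intro one_less_power) auto
  then have "Polynomial.coeff p (q^3) = 1"
    using q_ge by (simp add: p_def coeff_pCons split: nat.split)
  then have p0: "p \<noteq> 0" by auto
  have dp: "Polynomial.degree p \<le> q ^ 3"
    unfolding p_def using \<open>1 < q ^ 3\<close> by (intro degree_diff_le) (auto simp: degree_monom_le)
  have iff: "poly p y = 0 \<longleftrightarrow> \<sigma> (\<sigma> (\<sigma> y)) = y" for y
    by (simp add: p_def poly_monom frob_def power3_eq_cube flip: power_mult)
  have sub: "range (to_ac :: 'a \<Rightarrow> _) \<subseteq> {y. poly p y = 0}"
    unfolding iff by (auto simp flip: to_ac_frob)
  have "card {y. poly p y = 0} \<le> card (range (to_ac :: 'a \<Rightarrow> _))"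
    using card_poly_roots_bound[OF p0] dp card_field by (simp add: card_image inj_to_ac)
  then have "range (to_ac :: 'a \<Rightarrow> _) = {y. poly p y = 0}"
    using sub poly_roots_finite[OF p0] by (intro card_seteq) auto
  then show "x \<in> range to_ac" using x iff by blast
next
  assume "x \<in> range (to_ac :: 'a \<Rightarrow> _)"
  then show "\<sigma> (\<sigma> (\<sigma> x)) = x" by (auto simp flip: to_ac_frob)
qed

lemma Fq_iff: "x \<in> Fq q \<longleftrightarrow> \<sigma> x = (x::'a)"
  by (simp add: Fq_def frob_def)

lemma card_poly_zeros_le:
  assumes "\<And>x::'a. P x \<Longrightarrow> poly p x = 0" "p \<noteq> 0" "Polynomial.degree p \<le> d"
  shows "card {x. P x} \<le> d"
proof -
  have "card {x. P x} \<le> card {x. poly p x = 0}" using assms by (intro card_mono) auto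
  then show ?thesis using card_poly_roots_bound[OF assms(2)] assms(3) by linarith
qed

lemma card_Fq_le: "card (Fq q :: 'a set) \<le> q"
proof -
  define p :: "'a poly" where "p = Polynomial.monom 1 q - [:0, 1:]"
  have "Polynomial.coeff p q = 1" using q_ge by (simp add: p_def coeff_pCons split: nat.split)
  then have p0: "p \<noteq> 0" by auto
  have "Polynomial.degree p \<le> q"
    unfolding p_def using q_ge by (intro degree_diff_le) (auto simp: degree_monom_le)
  then show ?thesis unfolding Fq_def using p0
    by (intro card_poly_zeros_le[of _ p]) (auto simp: p_def poly_monom)
qed

section \<open>Relative trace and norm, and the sizes of their fibres\<close>

definition tr :: "'a \<Rightarrow> 'a" where "tr x = x + \<sigma> x + \<sigma> (\<sigma> x)"
definition nm :: "'a \<Rightarrow> 'a" where "nm x = x * \<sigma> x * \<sigma> (\<sigma> x)"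

lemma tr_in_Fq: "tr x \<in> Fq q" and nm_in_Fq: "nm x \<in> Fq q"
  by (simp_all add: Fq_iff tr_def nm_def ac_simps)

lemma nm_eq_0_iff [simp]: "nm x = 0 \<longleftrightarrow> x = 0"
  by (simp add: nm_def)

lemma card_tr_fibre_le: "card {x. tr x = c} \<le> q\<^sup>2"
proof -
  define p :: "'a poly" where "p = Polynomial.monom 1 (q^2) + Polynomial.monom 1 q + [:-c, 1:]"
  have "q < q\<^sup>2" using q_ge by (simp add: power2_eq_square)
  then have "Polynomial.coeff p (q^2) = 1" using q_ge
    by (simp add: p_def coeff_pCons split: nat.split)
  then have p0: "p \<noteq> 0" by auto
  have "Polynomial.degree p \<le> q^2"
    unfolding p_def using q_ge \<open>q < q\<^sup>2\<close>
    by (intro degree_add_le) (auto intro: order.trans[OF degree_monom_le])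
  then show ?thesis using p0
    by (intro card_poly_zeros_le[of _ p])
      (auto simp: p_def poly_monom tr_def frob_def power2_eq_square power_mult)
qed

lemma card_nm_fibre_le: "card {x. nm x = c} \<le> q\<^sup>2 + q + 1"
proof -
  define p :: "'a poly" where "p = Polynomial.monom 1 (q^2 + q + 1) - [:c:]"
  have "Polynomial.coeff p (q^2 + q + 1) = 1" by (simp add: p_def)
  then have p0: "p \<noteq> 0" by auto
  have "Polynomial.degree p \<le> q^2 + q + 1"
    unfolding p_def by (intro degree_diff_le) (auto simp: degree_monom_le)
  then show ?thesis using p0
    by (intro card_poly_zeros_le[of _ p])
      (auto simp: p_def poly_monom nm_def frob_def power2_eq_square power_add power_mult mult_ac)
qed

text \<open>The bound q on the number of trace values and the bound q^2 on each fibre multiply to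
  q^3, the size of the field, so both are attained. This yields the size of \<open>Fq\<close> and
  the surjectivity of the trace at once.\<close>

lemma card_Fq: "card (Fq q :: 'a set) = q"
  and card_tr_fibre: "c \<in> Fq q \<Longrightarrow> card {x. tr x = c} = q\<^sup>2"
  using fibres_tight[of "UNIV :: 'a set" "Fq q" tr q "q\<^sup>2"] q_ge card_Fq_le card_tr_fibre_le
    card_field tr_in_Fq
  by (auto simp: power2_eq_square power3_eq_cube)

text \<open>The same counting on the nonzero elements, through q^3 - 1 = (q - 1) (q^2 + q +
  1).\<close>

lemma card_nm_fibre:
  assumes "c \<in> Fq q" "c \<noteq> 0"
  shows "card {x. nm x = c} = q\<^sup>2 + q + 1"
proof -
  have "card (UNIV - {0::'a}) = q ^ 3 - 1" using card_field by (simp add: card_Diff_singleton)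
  also have "\<dots> = (q - 1) * (q\<^sup>2 + q + 1)"
    using q_ge by (simp add: algebra_simps power2_eq_square power3_eq_cube)
  finally have c1: "card (UNIV - {0::'a}) = (q - 1) * (q\<^sup>2 + q + 1)" .
  have c2: "card (Fq q - {0::'a}) \<le> q - 1"
    using card_Fq by (simp add: card_Diff_singleton Fq_iff)
  have c3: "card {x \<in> UNIV - {0}. nm x = d} \<le> q\<^sup>2 + q + 1" for d
    using card_nm_fibre_le[of d] card_mono[of "{x. nm x = d}" "{x \<in> UNIV - {0}. nm x = d}"]
    by fastforce
  have "card {x \<in> UNIV - {0}. nm x = c} = q\<^sup>2 + q + 1"
    by (rule fibres_tight(2)[where m = "q - 1" and C = "Fq q - {0}"])
      (use c1 c2 c3 assms nm_in_Fq in auto)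
  moreover have "{x \<in> UNIV - {0}. nm x = c} = {x. nm x = c}" using assms by auto
  ultimately show ?thesis by simp
qed

subsection \<open>Linear algebra over the subfield\<close>

lemma Fq_zero [simp]: "0 \<in> Fq q" and Fq_one [simp]: "1 \<in> Fq q"
  using q_ge by (simp_all add: Fq_def)

lemma Fq_add: "x \<in> Fq q \<Longrightarrow> y \<in> Fq q \<Longrightarrow> x + y \<in> Fq q"
  and Fq_diff: "x \<in> Fq q \<Longrightarrow> y \<in> Fq q \<Longrightarrow> x - y \<in> Fq q"
  and Fq_mult: "x \<in> Fq q \<Longrightarrow> y \<in> Fq q \<Longrightarrow> x * y \<in> Fq q"
  and Fq_divide: "x \<in> Fq q \<Longrightarrow> y \<in> Fq q \<Longrightarrow> x / y \<in> Fq q"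
  and Fq_minus: "x \<in> Fq q \<Longrightarrow> - x \<in> Fq q" for x y :: 'a
  by (simp_all add: Fq_iff)

text \<open>Families rather than sets of vectors, so that the parameters of points can serve as
  indices. Membership of the coefficients in \<open>Fq\<close> is imposed where it is
  needed.\<close>

definition Lc :: "'i set \<Rightarrow> ('i \<Rightarrow> 'a ^ 8) \<Rightarrow> ('i \<Rightarrow> 'a) \<Rightarrow> 'a ^ 8" where
  "Lc I f c = (\<Sum>i\<in>I. c i *s f i)"

lemma fspan_image:
  assumes "finite I" "inj_on f I"
  shows "fspan q (f ` I) = {Lc I f c | c. \<forall>i\<in>I. c i \<in> Fq q}" (is "?L = ?R")
proof
  show "?L \<subseteq> ?R"
  proof
    fix x assume "x \<in> ?L"
    then obtain F c where F: "finite F" "F \<subseteq> f ` I" "\<forall>v\<in>F. c v \<in> Fq q" "x = (\<Sum>v\<in>F. c v *s v)"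
      unfolding fspan_def by blast
    define d where "d i = (if f i \<in> F then c (f i) else 0)" for i
    have "x = (\<Sum>v\<in>f ` I. (if v \<in> F then c v else 0) *s v)"
      unfolding F(4) using assms F(2) by (intro sum.mono_neutral_cong_left) auto
    also have "\<dots> = Lc I f d"
      unfolding Lc_def d_def by (subst sum.reindex) (use assms in auto)
    finally show "x \<in> ?R" using F(3) by (auto simp: d_def)
  qed
  show "?R \<subseteq> ?L"
  proof
    fix x assume "x \<in> ?R"
    then obtain c where c: "x = Lc I f c" "\<forall>i\<in>I. c i \<in> Fq q" by blast
    define d where "d = c \<circ> inv_into I f"
    have "x = (\<Sum>v\<in>f ` I. d v *s v)"
      unfolding c(1) Lc_def by (subst sum.reindex) (use assms in \<open>auto simp: d_def\<close>)
    moreover have "\<forall>v\<in>f ` I. d v \<in> Fq q" using c(2) assms by (auto simp: d_def)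
    ultimately show "x \<in> ?L" unfolding fspan_def using assms by blast
  qed
qed

lemma fspan_eq: "fspan q B = {Lc B (\<lambda>v. v) c | c. \<forall>v\<in>B. c v \<in> Fq q}"
  using fspan_image[of B "\<lambda>v. v"] by simp

lemma Lc_in_subspace:
  assumes "fsubspace q W" "\<And>i. i \<in> I \<Longrightarrow> f i \<in> W" "\<And>i. i \<in> I \<Longrightarrow> c i \<in> Fq q"
  shows "Lc I f c \<in> W"
  using assms(2,3) unfolding Lc_def
  by (induction I rule: infinite_finite_induct) (use assms(1) in \<open>auto simp: fsubspace_def\<close>)

lemma fspan_least: "fsubspace q W \<Longrightarrow> S \<subseteq> W \<Longrightarrow> fspan q S \<subseteq> (W :: ('a ^ 8) set)"
  by (auto simp: fspan_eq intro!: Lc_in_subspace)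

lemma fspan_superset: "S \<subseteq> fspan q (S :: ('a ^ 8) set)"
proof
  fix v assume "v \<in> S"
  then have "v = Lc S (\<lambda>v. v) (\<lambda>w. if w = v then 1 else 0)"
    by (simp add: Lc_def if_distrib[of "\<lambda>c. c *s _"] cong: if_cong)
  then show "v \<in> fspan q S" unfolding fspan_eq by force
qed

lemma fsubspace_fspan: "fsubspace q (fspan q (S :: ('a ^ 8) set))"
  unfolding fsubspace_def
proof (intro conjI ballI)
  show "0 \<in> fspan q S" unfolding fspan_eq
    by (rule CollectI, rule exI[of _ "\<lambda>_. 0"]) (simp add: Lc_def)
next
  fix v w assume "v \<in> fspan q S" "w \<in> fspan q S"
  then obtain c d where "v = Lc S (\<lambda>v. v) c" "w = Lc S (\<lambda>v. v) d"
    "\<forall>v\<in>S. c v \<in> Fq q" "\<forall>v\<in>S. d v \<in> Fq q" unfolding fspan_eq by blast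
  then show "v + w \<in> fspan q S" unfolding fspan_eq
    by (intro CollectI exI[of _ "\<lambda>v. c v + d v"])
      (auto simp: Lc_def sum.distrib vector_sadd_rdistrib intro: Fq_add)
next
  fix k :: 'a and v assume "k \<in> Fq q" "v \<in> fspan q S"
  then obtain c where "v = Lc S (\<lambda>v. v) c" "\<forall>v\<in>S. c v \<in> Fq q" unfolding fspan_eq by blast
  then show "k *s v \<in> fspan q S" unfolding fspan_eq using \<open>k \<in> Fq q\<close>
    by (intro CollectI exI[of _ "\<lambda>v. k * c v"])
      (auto simp: Lc_def vec.scale_sum_right vector_smult_assoc intro: Fq_mult)
qed

lemma fspan_mono: "S \<subseteq> T \<Longrightarrow> fspan q S \<subseteq> fspan q (T :: ('a ^ 8) set)"
  by (meson fspan_least fspan_superset fsubspace_fspan order_trans)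

lemma Lc_diff: "Lc I f c - Lc I f d = Lc I f (\<lambda>i. c i - d i)"
  by (simp add: Lc_def sum_subtractf vector_sub_rdistrib)

lemma dependent_in_span:
  assumes "finite I" "Lc I f c = 0" "\<And>i. i \<in> I \<Longrightarrow> c i \<in> Fq q" "j \<in> I" "c j \<noteq> 0"
  shows "f j \<in> fspan q (f ` (I - {j}))"
proof -
  have "c j *s f j + Lc (I - {j}) f c = 0"
    using assms by (simp add: Lc_def sum.remove)
  then have "inverse (c j) *s (c j *s f j) = inverse (c j) *s (- Lc (I - {j}) f c)"
    by (metis add_eq_0_iff2)
  then have "f j = - Lc (I - {j}) f (\<lambda>i. inverse (c j) * c i)"
    using assms(5) by (simp add: Lc_def vec.scale_sum_right vector_smult_assoc)
  also have "\<dots> = Lc (I - {j}) f (\<lambda>i. - c i / c j)"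
    unfolding Lc_def sum_negf[symmetric]
    by (intro sum.cong refl) (simp add: vector_smult_lneg divide_inverse mult.commute)
  finally have "f j = Lc (I - {j}) f (\<lambda>i. - c i / c j)" .
  moreover have "Lc (I - {j}) f (\<lambda>i. - c i / c j) \<in> fspan q (f ` (I - {j}))"
    by (rule Lc_in_subspace[OF fsubspace_fspan])
      (use assms fspan_superset[of "f ` (I - {j})"] in \<open>auto intro!: Fq_divide Fq_minus\<close>)
  ultimately show ?thesis by simp
qed

text \<open>Only coefficients in \<open>Fq\<close> count, although the vectors have entries in the
  larger field: dimensions are those over the small field.\<close>

definition indep :: "'i set \<Rightarrow> ('i \<Rightarrow> 'a ^ 8) \<Rightarrow> bool" where
  "indep I f \<longleftrightarrow> (\<forall>c. (\<forall>i\<in>I. c i \<in> Fq q) \<and> Lc I f c = 0 \<longrightarrow> (\<forall>i\<in>I. c i = 0))"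

lemma indepD:
  "indep I f \<Longrightarrow> (\<And>i. i \<in> I \<Longrightarrow> c i \<in> Fq q) \<Longrightarrow> Lc I f c = 0 \<Longrightarrow> i \<in> I \<Longrightarrow> c i = 0"
  by (auto simp: indep_def)

lemma Lc_restrict: "Lc I f (restrict c I) = Lc I f c"
  by (simp add: Lc_def)

lemma Lc_PiE: "Lc I f ` (I \<rightarrow>\<^sub>E Fq q) = {Lc I f c | c. \<forall>i\<in>I. c i \<in> Fq q}"
proof -
  have "Lc I f c \<in> Lc I f ` (I \<rightarrow>\<^sub>E Fq q)" if "\<forall>i\<in>I. c i \<in> Fq q" for c
    by (rule image_eqI[of _ _ "restrict c I"]) (use that in \<open>auto simp: Lc_restrict\<close>)
  then show ?thesis by auto
qed

lemma indep_inj_on: "finite I \<Longrightarrow> indep I f \<longleftrightarrow> inj_on (Lc I f) (I \<rightarrow>\<^sub>E Fq q)"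
proof
  assume "indep I f"
  show "inj_on (Lc I f) (I \<rightarrow>\<^sub>E Fq q)"
  proof (rule inj_onI)
    fix c d assume cd: "c \<in> I \<rightarrow>\<^sub>E Fq q" "d \<in> I \<rightarrow>\<^sub>E Fq q" "Lc I f c = Lc I f d"
    have "Lc I f (\<lambda>i. c i - d i) = 0" using cd(3) by (simp flip: Lc_diff)
    moreover have "\<And>i. i \<in> I \<Longrightarrow> c i - d i \<in> Fq q" using cd by (auto intro!: Fq_diff)
    ultimately have "c i - d i = 0" if "i \<in> I" for i
      using indepD[OF \<open>indep I f\<close>, of "\<lambda>i. c i - d i"] that by presburger
    then show "c = d" using cd by (metis PiE_ext eq_iff_diff_eq_0)
  qed
next
  assume inj: "inj_on (Lc I f) (I \<rightarrow>\<^sub>E Fq q)"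
  show "indep I f" unfolding indep_def
  proof (intro allI impI)
    fix c assume c: "(\<forall>i\<in>I. c i \<in> Fq q) \<and> Lc I f c = 0"
    then have "Lc I f (restrict c I) = Lc I f (restrict (\<lambda>_. 0) I)"
      by (simp add: Lc_restrict) (simp add: Lc_def)
    then have "restrict c I = restrict (\<lambda>_. 0) I"
      by (rule inj_onD[OF inj]) (use c in auto)
    then show "\<forall>i\<in>I. c i = 0" by (metis restrict_apply')
  qed
qed

lemma indep_imp_inj_on:
  assumes "finite I" "indep I f"
  shows "inj_on f I"
proof (rule inj_onI, rule ccontr)
  fix i j assume ij: "i \<in> I" "j \<in> I" "f i = f j" "i \<noteq> j"
  \<comment> \<open>Two equal members would satisfy the relation with coefficients 1 and -1.\<close>
  define c :: "_ \<Rightarrow> 'a" where "c k = (if k = i then 1 else if k = j then -1 else 0)" for k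
  have "Lc I f c = (\<Sum>k\<in>{i, j}. c k *s f k)"
    unfolding Lc_def using assms ij by (intro sum.mono_neutral_right) (auto simp: c_def)
  also have "\<dots> = 0" using ij by (simp add: c_def vector_smult_lneg)
  finally have "Lc I f c = 0" .
  moreover have "\<forall>k\<in>I. c k \<in> Fq q" using Fq_minus[OF Fq_one] by (simp add: c_def)
  ultimately have "c i = 0" using assms(2) ij unfolding indep_def by blast
  then show False by (simp add: c_def)
qed

text \<open>Dimension theory is carried out by counting: independence makes the coefficient map
  injective, so the size of a span reveals its dimension.\<close>

lemma card_fspan_indep:
  assumes "finite I" "indep I f"
  shows "card (fspan q (f ` I)) = q ^ card I"
proof -
  have "fspan q (f ` I) = Lc I f ` (I \<rightarrow>\<^sub>E Fq q)"
    using fspan_image[OF assms(1) indep_imp_inj_on[OF assms]] by (simp add: Lc_PiE)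
  then show ?thesis using assms indep_inj_on[of I f]
    by (simp add: card_image card_PiE card_Fq)
qed

lemma card_fsubspace_ge:
  assumes "finite I" "indep I f" "fsubspace q W" "\<And>i. i \<in> I \<Longrightarrow> f i \<in> W"
  shows "q ^ card I \<le> card W"
proof -
  have "fspan q (f ` I) \<subseteq> W" using assms by (intro fspan_least) auto
  then have "card (fspan q (f ` I)) \<le> card W" by (intro card_mono) auto
  then show ?thesis using card_fspan_indep[OF assms(1,2)] by simp
qed

text \<open>\<open>fdim\<close> is the least size of a spanning set, and a spanning set of least
  size is independent: a vector occurring in a relation lies in the span of the others and could be
  removed.\<close>

lemma fdim_basis:
  fixes W :: "('a ^ 8) set"
  assumes "fsubspace q W"
  obtains B where "card B = fdim q W" "fspan q B = W" "indep B (\<lambda>v. v)"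
proof -
  let ?P = "\<lambda>n. \<exists>B. finite B \<and> card B = n \<and> B \<subseteq> W \<and> fspan q B = W"
  have "fspan q W = W" using assms fspan_least fspan_superset by blast
  then have "?P (card W)" by (intro exI[of _ W]) auto
  then have "?P (fdim q W)" unfolding fdim_def by (rule LeastI)
  then obtain B where B: "card B = fdim q W" "B \<subseteq> W" "fspan q B = W" by blast
  have "indep B (\<lambda>v. v)"
  proof (rule ccontr)
    assume "\<not> ?thesis"
    then obtain c j where c: "\<forall>i\<in>B. c i \<in> Fq q" "Lc B (\<lambda>v. v) c = 0" "j \<in> B" "c j \<noteq> 0"
      unfolding indep_def by blast
    then have "j \<in> fspan q (B - {j})"
      using dependent_in_span[of B "\<lambda>v. v" c j] by simp
    then have "B \<subseteq> fspan q (B - {j})" using fspan_superset[of "B - {j}"] by auto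
    then have "W \<subseteq> fspan q (B - {j})" using B(3) fspan_least fsubspace_fspan by metis
    moreover have "fspan q (B - {j}) \<subseteq> W" using fspan_mono[of "B - {j}" B] B(3) by auto
    ultimately have "?P (card (B - {j}))" using B(2) by (intro exI[of _ "B - {j}"]) auto
    then have "fdim q W \<le> card (B - {j})" unfolding fdim_def by (rule Least_le)
    then show False using B(1) card_Diff1_less[of B j] c(3) by simp
  qed
  with B that show ?thesis by blast
qed

lemma card_fsubspace: 
  fixes W :: "('a ^ 8) set"
  assumes "fsubspace q W"
  shows "card W = q ^ fdim q W"
  using fdim_basis[OF assms] card_fspan_indep[where f = "\<lambda>v. v"] by (metis finite image_ident)

end

section \<open>Hyperplanes as zero sets of forms\<close>

lemma exhaust_8: "x = 1 \<or> x = 2 \<or> x = 3 \<or> x = 4 \<or> x = 5 \<or> x = 6 \<or> x = 7 \<or> x = (8::8)"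
proof (induct x)
  case (of_int z)
  then have "z = 0 \<or> z = 1 \<or> z = 2 \<or> z = 3 \<or> z = 4 \<or> z = 5 \<or> z = 6 \<or> z = 7" by (simp, arith)
  then show ?case by auto
qed

lemma UNIV_8: "UNIV = {1, 2, 3, 4, 5, 6, 7, 8::8}"
  using exhaust_8 by auto

lemma sum_8: "sum f (UNIV::8 set) = f 1 + f 2 + f 3 + f 4 + f 5 + f 6 + f 7 + f 8"
  unfolding UNIV_8 by (simp add: ac_simps)

lemma forall_8: "(\<forall>i::8. P i) \<longleftrightarrow> P 1 \<and> P 2 \<and> P 3 \<and> P 4 \<and> P 5 \<and> P 6 \<and> P 7 \<and> P 8"
  by (metis exhaust_8)

lemma vector_8:
  "(vector [a1, a2, a3, a4, a5, a6, a7, a8] :: 'b::zero ^ 8) $ 1 = a1"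
  "(vector [a1, a2, a3, a4, a5, a6, a7, a8] :: 'b::zero ^ 8) $ 2 = a2"
  "(vector [a1, a2, a3, a4, a5, a6, a7, a8] :: 'b::zero ^ 8) $ 3 = a3"
  "(vector [a1, a2, a3, a4, a5, a6, a7, a8] :: 'b::zero ^ 8) $ 4 = a4"
  "(vector [a1, a2, a3, a4, a5, a6, a7, a8] :: 'b::zero ^ 8) $ 5 = a5"
  "(vector [a1, a2, a3, a4, a5, a6, a7, a8] :: 'b::zero ^ 8) $ 6 = a6"
  "(vector [a1, a2, a3, a4, a5, a6, a7, a8] :: 'b::zero ^ 8) $ 7 = a7"
  "(vector [a1, a2, a3, a4, a5, a6, a7, a8] :: 'b::zero ^ 8) $ 8 = a8"
  by (simp_all add: vector_def)

context cubic_field begin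

lemma power_q_sq: "x ^ q\<^sup>2 = \<sigma> (\<sigma> x)" for x :: "'b::monoid_mult"
  by (simp add: frob_def power2_eq_square power_mult)

lemma Pvec_nth:
  "Pvec q a b c d $ 1 = (a::'a)" "Pvec q a b c d $ 2 = \<sigma> (\<sigma> b)" "Pvec q a b c d $ 3 = \<sigma> b"
  "Pvec q a b c d $ 4 = c" "Pvec q a b c d $ 5 = b" "Pvec q a b c d $ 6 = \<sigma> c"
  "Pvec q a b c d $ 7 = \<sigma> (\<sigma> c)" "Pvec q a b c d $ 8 = d"
  unfolding Pvec_def power_q_sq by (simp_all add: vector_8 frob_def)

lemma Pvec_eq_iff: "Pvec q a b c d = Pvec q a' b' c' d' \<longleftrightarrow> a = a' \<and> b = b' \<and> c = c' \<and> d = (d'::'a)"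
  by (auto simp: vec_eq_iff forall_8 Pvec_nth)

lemma Pvec_add: "Pvec q a b c d + Pvec q a' b' c' d' = Pvec q (a + a') (b + b') (c + c') (d + d'::'a)"
  by (simp add: vec_eq_iff forall_8 Pvec_nth)

lemma Pvec_smult: "k \<in> Fq q \<Longrightarrow> k *s Pvec q a b c d = Pvec q (k * a) (k * b) (k * c) (k * d::'a)"
  by (simp add: vec_eq_iff forall_8 Pvec_nth Fq_iff)

lemma Pvec_zero: "Pvec q 0 0 0 0 = (0 :: 'a ^ 8)"
  by (simp add: vec_eq_iff forall_8 Pvec_nth)

lemma fsubspace_U1: "fsubspace q (U1 q :: ('a ^ 8) set)"
  unfolding fsubspace_def
proof (intro conjI ballI)
  show "0 \<in> (U1 q :: ('a ^ 8) set)"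
    unfolding U1_def using Pvec_zero Fq_zero by (metis (mono_tags, lifting) mem_Collect_eq)
next
  fix v w :: "'a ^ 8" assume "v \<in> U1 q" "w \<in> U1 q"
  then show "v + w \<in> U1 q" unfolding U1_def using Pvec_add Fq_add by (smt (verit) mem_Collect_eq)
next
  fix k :: 'a and v :: "'a ^ 8" assume "k \<in> Fq q" "v \<in> U1 q"
  then show "k *s v \<in> U1 q" unfolding U1_def using Pvec_smult Fq_mult by (smt (verit) mem_Collect_eq)
qed

lemma fsubspace_diff:
  fixes W :: "('a ^ 8) set"
  assumes "fsubspace q W" "v \<in> W" "w \<in> W"
  shows "v - w \<in> W"
proof -
  have "(-1) *s w \<in> W" using assms Fq_minus[OF Fq_one] unfolding fsubspace_def by blast
  then have "v + (-1) *s w \<in> W" using assms unfolding fsubspace_def by blast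
  then show ?thesis by (simp add: vector_smult_lneg)
qed

lemma card_U1: "card (U1 q :: ('a ^ 8) set) = q ^ 8"
proof -
  have "U1 q = (\<lambda>(a, b, c, d). Pvec q a b c d) ` (Fq q \<times> (UNIV :: 'a set) \<times> (UNIV :: 'a set) \<times> Fq q)"
    unfolding U1_def by (auto simp: image_iff) blast
  moreover have "inj_on (\<lambda>(a, b, c, d). Pvec q a b c (d::'a)) (Fq q \<times> UNIV \<times> UNIV \<times> Fq q)"
    by (auto simp: inj_on_def Pvec_eq_iff)
  ultimately have "card (U1 q :: ('a ^ 8) set) = 
      card ((Fq q :: 'a set) \<times> (UNIV :: 'a set) \<times> (UNIV :: 'a set) \<times> (Fq q :: 'a set))"
    by (simp add: card_image)
  then show ?thesis by (simp add: card_cartesian_product card_Fq card_field eval_nat_numeral)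
qed

section \<open>Self-duality of U1 and normal vectors of hyperplanes\<close>

definition dot :: "'a ^ 8 \<Rightarrow> 'a ^ 8 \<Rightarrow> 'a" where
  "dot v w = (\<Sum>i\<in>UNIV. v $ i * w $ i)"

lemma dot_add: "dot v (w + w') = dot v w + dot v w'"
  and dot_diff_left: "dot (v - v') w = dot v w - dot v' w"
  and dot_smult: "dot v (k *s w) = k * dot v w"
  and dot_zero: "dot v 0 = 0"
  by (simp_all add: dot_def sum_8 algebra_simps)

lemma dot_Pvec: "dot (Pvec q a b c d) (Pvec q a' b' c' d') = a * a' + tr (b * b') + tr (c * c') + d * d'"
  by (simp add: dot_def sum_8 Pvec_nth tr_def)

lemma dot_in_Fq: "v \<in> U1 q \<Longrightarrow> w \<in> U1 q \<Longrightarrow> dot v w \<in> Fq q"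
  by (auto simp: U1_def dot_Pvec intro!: Fq_add Fq_mult tr_in_Fq)

text \<open>Nondegeneracy of the trace form: the trace takes the value 1, and multiplication by b is
  onto.\<close>

lemma tr_mult_nonzero:
  assumes "b \<noteq> 0"
  obtains x where "tr (b * x) \<noteq> 0"
proof -
  have "card {x. tr x = 1} = q\<^sup>2" by (rule card_tr_fibre) simp
  then have "{x. tr x = 1} \<noteq> {}" using q_ge by (metis card.empty not_numeral_le_zero power_not_zero)
  then obtain y where "tr y = 1" by blast
  then have "tr (b * (y / b)) \<noteq> 0" using assms by simp
  with that show ?thesis by blast
qed

lemma dot_nondegenerate:
  assumes "v \<in> U1 q" "v \<noteq> 0"
  obtains w where "w \<in> U1 q" "dot v w \<noteq> 0"
proof -
  obtain a b c d where v: "v = Pvec q a b c d" using assms by (auto simp: U1_def)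
  have U: "Pvec q a' b' c' d' \<in> U1 q" if "a' \<in> Fq q" "d' \<in> Fq q" for a' b' c' d' :: 'a
    using that unfolding U1_def by blast
  consider "a \<noteq> 0" | "b \<noteq> 0" | "c \<noteq> 0" | "d \<noteq> 0" using assms v Pvec_zero by force
  then show ?thesis
  proof cases
    case 1
    then show ?thesis by (intro that[of "Pvec q 1 0 0 0"] U) (auto simp: v dot_Pvec tr_def)
  next
    case 2
    then obtain x where "tr (b * x) \<noteq> 0" using tr_mult_nonzero by blast
    then show ?thesis by (intro that[of "Pvec q 0 x 0 0"] U) (auto simp: v dot_Pvec tr_def)
  next
    case 3
    then obtain x where "tr (c * x) \<noteq> 0" using tr_mult_nonzero by blast
    then show ?thesis by (intro that[of "Pvec q 0 0 x 0"] U) (auto simp: v dot_Pvec tr_def)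
  next
    case 4
    then show ?thesis by (intro that[of "Pvec q 0 0 0 1"] U) (auto simp: v dot_Pvec tr_def)
  qed
qed

definition perp :: "('a ^ 8) set \<Rightarrow> ('a ^ 8) set" where
  "perp B = {v \<in> U1 q. \<forall>w\<in>B. dot v w = 0}"

text \<open>Pairing with the members of B sends U1 to at most q^(card B) value tables, and each
  nonempty fibre embeds in \<open>perp B\<close> by subtracting one of its elements. This is the
  half of the dimension formula for orthogonal complements that the counting needs.\<close>

lemma card_perp_ge:
  assumes "B \<subseteq> U1 q"
  shows "q ^ 8 \<le> q ^ card B * card (perp B)"
proof -
  define ev where "ev v = restrict (dot v) B" for v
  have im: "ev ` U1 q \<subseteq> B \<rightarrow>\<^sub>E Fq q"
    using assms dot_in_Fq by (auto simp: ev_def)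
  have fib: "card {v \<in> U1 q. ev v = e} \<le> card (perp B)" for e
  proof (cases "\<exists>v0\<in>U1 q. ev v0 = e")
    case True
    then obtain v0 where v0: "v0 \<in> U1 q" "ev v0 = e" by blast
    have "(\<lambda>v. v - v0) ` {v \<in> U1 q. ev v = e} \<subseteq> perp B"
    proof
      fix u assume "u \<in> (\<lambda>v. v - v0) ` {v \<in> U1 q. ev v = e}"
      then obtain v where v: "v \<in> U1 q" "ev v = e" "u = v - v0" by auto
      have "dot v w = dot v0 w" if "w \<in> B" for w
        using v v0 that unfolding ev_def by (metis restrict_apply')
      then show "u \<in> perp B"
        using v v0 fsubspace_diff[OF fsubspace_U1] by (simp add: perp_def dot_diff_left)
    qed
    moreover have "inj_on (\<lambda>v. v - v0) {v \<in> U1 q. ev v = e}" by (auto simp: inj_on_def)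
    ultimately show ?thesis by (intro card_inj_on_le[of "\<lambda>v. v - v0"]) auto
  next
    case False
    then have "{v \<in> U1 q. ev v = e} = {}" by blast
    then show ?thesis by (metis card.empty zero_le)
  qed
  have fin: "finite (B \<rightarrow>\<^sub>E (Fq q :: 'a set))" by (intro finite_PiE) auto
  have "q ^ 8 = (\<Sum>e\<in>B \<rightarrow>\<^sub>E (Fq q :: 'a set). card {v \<in> U1 q. ev v = e})"
    using sum.group[OF _ fin im, of "\<lambda>_. 1::nat"] card_U1 by simp
  also have "\<dots> \<le> (\<Sum>e\<in>B \<rightarrow>\<^sub>E (Fq q :: 'a set). card (perp B))"
    by (rule sum_mono) (rule fib)
  also have "\<dots> = q ^ card B * card (perp B)" by (simp add: card_PiE card_Fq)
  finally show ?thesis .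
qed

lemma perp_fspan: "perp (fspan q B) = perp B"
proof -
  have "dot v w = 0" if "\<forall>u\<in>B. dot v u = 0" "w \<in> fspan q B" for v w
  proof -
    have "fsubspace q {w. dot v w = 0}" by (simp add: fsubspace_def dot_add dot_smult dot_zero)
    then have "fspan q B \<subseteq> {w. dot v w = 0}" using that by (intro fspan_least) auto
    then show ?thesis using that by blast
  qed
  then show ?thesis unfolding perp_def using fspan_superset by blast
qed

lemma card_perp_subspace_ge:
  assumes "fsubspace q W" "W \<subseteq> U1 q"
  shows "q ^ 8 \<le> q ^ fdim q W * card (perp W)"
  using fdim_basis[OF assms(1)] card_perp_ge perp_fspan assms(2) fspan_superset
  by (metis subset_trans)

text \<open>Counting gives at least q vectors orthogonal to H, hence a nonzero one. Its kernel in U1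
  contains H and is proper, since the dot product is nondegenerate on U1; so it has at most q^7
  elements and equals H.\<close>

lemma hyperplane_equation:
  assumes "fsubspace q H" "H \<subseteq> U1 q" "fdim q H = 7"
  obtains v where "v \<in> U1 q" "v \<noteq> 0" "H = {w \<in> U1 q. dot v w = 0}"
proof -
  have "q ^ 7 * q \<le> q ^ 7 * card (perp H)"
    using card_perp_subspace_ge[OF assms(1,2)] assms(3) by (simp add: eval_nat_numeral mult_ac)
  then have "q \<le> card (perp H)" using q_ge by simp
  then have "\<not> perp H \<subseteq> {0}" using q_ge card_mono[of "{0::'a^8}" "perp H"] by auto
  then obtain v where v: "v \<in> perp H" "v \<noteq> 0" by blast
  let ?K = "{w \<in> U1 q. dot v w = 0}"
  have K: "fsubspace q ?K"
    using fsubspace_U1 by (auto simp: fsubspace_def dot_add dot_smult dot_zero)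
  obtain w where "w \<in> U1 q" "dot v w \<noteq> 0" using dot_nondegenerate v by (auto simp: perp_def)
  then have "?K \<subset> U1 q" by blast
  then have "card ?K < card (U1 q :: ('a ^ 8) set)" by (rule psubset_card_mono[OF finite])
  then have "card ?K < q ^ 8" unfolding card_U1 .
  then have "fdim q ?K < 8" using card_fsubspace[OF K] q_ge by (simp add: power_strict_increasing_iff)
  then have "card ?K \<le> card H"
    using card_fsubspace[OF K] card_fsubspace[OF assms(1)] assms(3) q_ge
    by (simp add: power_increasing)
  moreover have "H \<subseteq> ?K" using v assms(2) by (auto simp: perp_def)
  ultimately have "H = ?K" by (intro card_seteq) auto
  then show ?thesis using that v by (auto simp: perp_def)
qed

section \<open>The points of O1, indexed by the projective line with \<open>None\<close> at
  infinity\<close>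

fun pt :: "'a option \<Rightarrow> 'a ^ 8" where
  "pt None = Pvec q 0 0 0 1"
| "pt (Some t) = Pvec q 1 t (\<sigma> t * \<sigma> (\<sigma> t)) (nm t)"

lemma pt_in_U1: "pt s \<in> U1 q"
  by (cases s) (auto simp: U1_def nm_in_Fq intro!: exI)

lemma fspan_pt_subset: "fsubspace q W \<Longrightarrow> fspan q {pt s} \<subseteq> W \<longleftrightarrow> pt s \<in> W"
  using fspan_superset[of "{pt s}"] fspan_least[of W "{pt s}"] by auto

lemma O1_eq: "O1 q = (\<lambda>s. fspan q {pt s}) ` (UNIV :: 'a option set)"
proof -
  have "Ppt q 1 t (t ^ (q\<^sup>2 + q)) (t ^ (q\<^sup>2 + q + 1)) = fspan q {pt (Some t)}" for t :: 'a
    unfolding Ppt_def pt.simps power_add power_q_sq nm_def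
    by (rule arg_cong[where f = "\<lambda>x. fspan q {x}"]) (simp add: Pvec_eq_iff frob_def mult_ac)
  moreover have "Ppt q 0 0 0 (1::'a) = fspan q {pt None}" by (simp add: Ppt_def)
  ultimately show ?thesis
    by (simp only: O1_def) (auto simp: UNIV_option_conv simp del: pt.simps)
qed

lemma fspan_single: "fspan q {v :: 'a ^ 8} = {k *s v | k. k \<in> Fq q}"
  using fspan_image[of "{()}" "\<lambda>_. v"] by (auto simp: Lc_def)

lemma inj_point: "inj (\<lambda>s :: 'a option. fspan q {pt s})"
proof (rule injI)
  fix s s' :: "'a option" assume "fspan q {pt s} = fspan q {pt s'}"
  then have "pt s' \<in> {k *s pt s | k. k \<in> Fq q}"
    using fspan_superset[of "{pt s'}"] by (simp add: fspan_single)
  then obtain k where k: "k \<in> Fq q" "pt s' = k *s pt s" by blast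
  show "s = s'"
    using k by (cases s; cases s') (auto simp: Pvec_smult Pvec_eq_iff)
qed

lemma points_in_subspace:
  assumes "fsubspace q W"
  shows "{P \<in> O1 q. P \<subseteq> W} = (\<lambda>s. fspan q {pt s}) ` {s. pt s \<in> W}"
  using fspan_pt_subset[OF assms] by (auto simp: O1_eq)

lemma card_points_in_subspace:
  assumes "fsubspace q W"
  shows "card {P \<in> O1 q. P \<subseteq> W} = card {s. pt s \<in> W}"
  unfolding points_in_subspace[OF assms] by (rule card_image) (rule inj_on_subset[OF inj_point], simp)

subsection \<open>Degenerate forms\<close>

definition form :: "'a \<Rightarrow> 'a \<Rightarrow> 'a \<Rightarrow> 'a \<Rightarrow> 'a option \<Rightarrow> 'a" where
  "form a b c d s = dot (Pvec q a b c d) (pt s)"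

lemma form_None: "form a b c d None = d"
  and form_Some: "form a b c d (Some t) = a + tr (b * t) + tr (c * (\<sigma> t * \<sigma> (\<sigma> t))) + d * nm t"
  by (simp_all add: form_def dot_Pvec tr_def)

lemma card_option_set: "card {s :: 'a option. P s} = card {t. P (Some t)} + (if P None then 1 else 0)"
proof -
  have "{s. P s} = Some ` {t. P (Some t)} \<union> (if P None then {None} else {})"
    by (auto simp: image_iff) (metis option.exhaust)+
  then have "card {s. P s} = card (Some ` {t. P (Some t)}) + card (if P None then {None :: 'a option} else {})"
    by (simp add: card_Un_disjoint disjoint_iff)
  then show ?thesis by (simp add: card_image)
qed

lemma card_shift: "card {t. P (t + s)} = card {t::'a. P t}"
  by (rule bij_betw_same_card[of "\<lambda>t. t + s"], rule bij_betw_byWitness[of _ "\<lambda>t. t - s"]) auto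

lemma card_scale: "b \<noteq> 0 \<Longrightarrow> card {t. P (b * t)} = card {t::'a. P t}"
  by (rule bij_betw_same_card[of "\<lambda>t. b * t"], rule bij_betw_byWitness[of _ "\<lambda>t. t / b"]) auto

text \<open>The analogue of completing the cube: the hypothesis says that b is the linear
  coefficient produced by expanding d * nm (t + c / d), so only a constant is left over.\<close>

lemma form_complete_cube:
  assumes "a \<in> Fq q" "d \<in> Fq q" "d \<noteq> 0" "d * b = \<sigma> c * \<sigma> (\<sigma> c)"
  shows "form a b c d (Some t) = d * nm (t + c / d) + (a - d * nm (c / d))"
proof -
  have d: "\<sigma> d = d" using assms by (simp add: Fq_iff)
  have b: "b = \<sigma> c * \<sigma> (\<sigma> c) / d" using assms by (simp add: field_simps)
  show ?thesis unfolding form_Some tr_def nm_def b using assms(3)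
    by (simp add: d field_simps)
qed

text \<open>The hypothesis on d * b means that the leading coefficient of the discriminant
  \<open>Qf\<close> below vanishes, so that it has a zero at infinity. For d nonzero the zeros form
  a norm fibre, of size 1 or q^2 + q + 1. For d = 0 also c = 0, and infinity is joined by the zeros
  of an affine trace function: q^2 of them, or none when b = 0.\<close>

lemma card_zeros_degenerate_at_infinity:
  assumes "a \<in> Fq q" "d \<in> Fq q" "d * b = \<sigma> c * \<sigma> (\<sigma> c)" "Pvec q a b c d \<noteq> 0"
  shows "card {s. form a b c d s = 0} \<in> {1, q\<^sup>2 + 1, q\<^sup>2 + q + 1}"
proof (cases "d = 0")
  case False
  \<comment> \<open>Chosen so that the form at \<open>Some t\<close> equals d * (nm (t + c / d) -
    e).\<close>
  define e where "e = nm (c / d) - a / d"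
  have e: "e \<in> Fq q" unfolding e_def using assms nm_in_Fq by (intro Fq_diff Fq_divide) auto
  have iff: "form a b c d (Some t) = 0 \<longleftrightarrow> nm (t + c / d) = e" for t
    unfolding form_complete_cube[OF assms(1,2) False assms(3)] e_def using False
    by (auto simp: field_simps)
  have "card {s. form a b c d s = 0} = card {t. nm (t + c / d) = e}"
    using False unfolding card_option_set iff by (simp add: form_None)
  also have "\<dots> = card {t. nm t = e}" by (rule card_shift)
  also have "\<dots> \<in> {1, q\<^sup>2 + 1, q\<^sup>2 + q + 1}"
    using card_nm_fibre[OF e] by (cases "e = 0") simp_all
  finally show ?thesis .
next
  case True
  then have c: "c = 0" using assms(3) by auto
  have iff: "form a b c d (Some t) = 0 \<longleftrightarrow> tr (b * t) = - a" for t
    using True c by (simp add: form_Some tr_def add_eq_0_iff)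
  have *: "card {s. form a b c d s = 0} = card {t. tr (b * t) = - a} + 1"
    using True unfolding card_option_set iff by (simp add: form_None)
  show ?thesis
  proof (cases "b = 0")
    case True
    then have "a \<noteq> 0" using assms(4) Pvec_zero c \<open>d = 0\<close> by auto
    then have "{t. tr (b * t) = - a} = {}" using True by (simp add: tr_def)
    then show ?thesis using * by simp
  next
    case False
    have "card {t. tr (b * t) = - a} = q\<^sup>2"
      using card_scale[OF False, of "\<lambda>t. tr t = - a"] card_tr_fibre[of "- a"] Fq_minus[OF assms(1)]
      by simp
    then show ?thesis using * by simp
  qed
qed

text \<open>The discriminant of the bilinear form obtained from the trilinear form of a hyperplane
  by fixing the first argument to x.\<close>

definition Qf :: "'a \<Rightarrow> 'a \<Rightarrow> 'a \<Rightarrow> 'a \<Rightarrow> 'a \<Rightarrow> 'a" where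
  "Qf a b c d x = (d * x + c) * (b * x + a) - (\<sigma> c * x + \<sigma> (\<sigma> b)) * (\<sigma> (\<sigma> c) * x + \<sigma> b)"

text \<open>The substitution t = t0 + 1 / r moves the zero t0 of \<open>Qf\<close> to infinity,
  where \<open>card_zeros_degenerate_at_infinity\<close> applies.\<close>

lemma card_zeros_degenerate:
  assumes ad: "a \<in> Fq q" "d \<in> Fq q" and root: "Qf a b c d t0 = 0" and nz: "Pvec q a b c d \<noteq> 0"
  shows "card {s. form a b c d s = 0} \<in> {1, q\<^sup>2 + 1, q\<^sup>2 + q + 1}"
proof -
  let ?p = "\<sigma> t0" and ?r = "\<sigma> (\<sigma> t0)"
  have sd: "\<sigma> d = d" "\<sigma> a = a" using ad by (auto simp: Fq_iff)
  \<comment> \<open>Coefficients after the translation by t0; d does not change. The inversion then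
    reverses the order of the four coefficients.\<close>
  define a' where "a' = form a b c d (Some t0)"
  define b' where "b' = b + \<sigma> (\<sigma> c) * ?p + \<sigma> c * ?r + d * ?p * ?r"
  define c' where "c' = c + d * t0"
  have a': "a' \<in> Fq q"
    unfolding a'_def form_Some using ad by (intro Fq_add Fq_mult tr_in_Fq nm_in_Fq) auto
  have shift: "form a b c d (Some (t0 + t)) = form a' b' c' d (Some t)" for t
    unfolding a'_def form_Some b'_def c'_def tr_def nm_def by (simp add: sd algebra_simps)
  have invert: "nm r * form a' b' c' d (Some (inverse r)) = form d c' b' a' (Some r)" if "r \<noteq> 0" for r
    using that unfolding form_Some tr_def nm_def by (simp add: field_simps)
  \<comment> \<open>The value of \<open>Qf\<close> at t0 is exactly the obstruction to the condition
    at infinity for the reversed form.\<close>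
  have deg: "a' * c' = \<sigma> b' * \<sigma> (\<sigma> b')"
  proof -
    have "a' * c' - \<sigma> b' * \<sigma> (\<sigma> b') = Qf a b c d t0"
      unfolding a'_def form_Some b'_def c'_def tr_def nm_def Qf_def by (simp add: sd algebra_simps)
    then show ?thesis using root by simp
  qed
  have "Pvec q d c' b' a' \<noteq> 0"
  proof
    assume "Pvec q d c' b' a' = 0"
    then have "d = 0" "c' = 0" "b' = 0" "a' = 0" by (simp_all add: Pvec_eq_iff flip: Pvec_zero)
    then have "d = 0" "c = 0" "b = 0" "a = 0"
      unfolding a'_def form_Some b'_def c'_def by (auto simp: tr_def)
    then show False using nz Pvec_zero by simp
  qed
  then have card: "card {s. form d c' b' a' s = 0} \<in> {1, q\<^sup>2 + 1, q\<^sup>2 + q + 1}"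
    using card_zeros_degenerate_at_infinity[OF ad(2) a', of c' b'] deg by simp
  \<comment> \<open>The substitution on the projective line, followed by its inverse: infinity goes
    to t0 and the parameter 0 goes to infinity.\<close>
  define \<phi> where "\<phi> s = (case s of None \<Rightarrow> Some t0 | Some r \<Rightarrow> if r = 0 then None else Some (t0 + inverse r))"
    for s
  define \<psi> where "\<psi> s = (case s of None \<Rightarrow> Some 0 | Some t \<Rightarrow> if t = t0 then None else Some (inverse (t - t0)))"
    for s
  have iff: "form a b c d (\<phi> s) = 0 \<longleftrightarrow> form d c' b' a' s = 0" for s
  proof (cases s)
    case None
    then show ?thesis by (simp add: \<phi>_def form_None a'_def)
  next
    case (Some r)
    show ?thesis
    proof (cases "r = 0")
      case True
      then show ?thesis using Some by (simp add: \<phi>_def form_None form_Some tr_def nm_def)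
    next
      case False
      then have "nm r \<noteq> 0" by simp
      then show ?thesis using Some False invert[OF False] shift[of "inverse r"]
        by (simp add: \<phi>_def) (metis mult_eq_0_iff nm_eq_0_iff)
    qed
  qed
  have "\<phi> (\<psi> s) = s" "\<psi> (\<phi> s) = s" for s
    by (auto simp: \<phi>_def \<psi>_def split: option.splits)
  then have "bij_betw \<phi> {s. form d c' b' a' s = 0} {s. form a b c d s = 0}"
    using iff by (intro bij_betw_byWitness[of _ \<psi>]) (auto, metis)
  then show ?thesis using card by (metis bij_betw_same_card)
qed

end

section \<open>Splitting of the nondegenerate forms\<close>

text \<open>The coefficients follow the coordinates of \<open>Pvec\<close>: the index minus one,
  read in binary, tells which of x1, y1, w1 replace x0, y0, w0. Substituting a point of the
  projective line and its two conjugates gives the pairing with \<open>pt\<close>.\<close>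

definition tri :: "'k::comm_ring_1 ^ 8 \<Rightarrow> 'k \<Rightarrow> 'k \<Rightarrow> 'k \<Rightarrow> 'k \<Rightarrow> 'k \<Rightarrow> 'k \<Rightarrow> 'k" where
  "tri e x0 x1 y0 y1 w0 w1 =
     e $ 1 * (x0 * y0 * w0) + e $ 2 * (x0 * y0 * w1) + e $ 3 * (x0 * y1 * w0) + e $ 4 * (x0 * y1 * w1) +
     e $ 5 * (x1 * y0 * w0) + e $ 6 * (x1 * y0 * w1) + e $ 7 * (x1 * y1 * w0) + e $ 8 * (x1 * y1 * w1)"

text \<open>Lagrange interpolation of a linear form in two variables at the nodes (1, p) and (1, r),
  with the denominator cleared.\<close>

lemma tri_interpolate_x:
  "(p - r) * tri e x0 x1 y0 y1 w0 w1 = (x1 - r * x0) * tri e 1 p y0 y1 w0 w1 - (x1 - p * x0) * tri e 1 r y0 y1 w0 w1"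
  and tri_interpolate_y:
  "(p - r) * tri e x0 x1 y0 y1 w0 w1 = (y1 - r * y0) * tri e x0 x1 1 p w0 w1 - (y1 - p * y0) * tri e x0 x1 1 r w0 w1"
  and tri_interpolate_w:
  "(p - r) * tri e x0 x1 y0 y1 w0 w1 = (w1 - r * w0) * tri e x0 x1 y0 y1 1 p - (w1 - p * w0) * tri e x0 x1 y0 y1 1 r"
  by (simp_all add: tri_def algebra_simps)

text \<open>Interpolating in each argument in turn expresses the form by its values at the eight
  corners of a grid. The nodes will be th, th' and their conjugates, where the form of the
  hyperplane has only two nonzero corner values.\<close>

lemma tri_interpolate:
  fixes p p' r r' s s' x0 x1 y0 y1 w0 w1 :: "'k::comm_ring_1" and e :: "'k ^ 8"
  defines "l \<equiv> x1 - p * x0" and "l' \<equiv> x1 - p' * x0" and "m \<equiv> y1 - r * y0" and "m' \<equiv> y1 - r' * y0"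
    and "n \<equiv> w1 - s * w0" and "n' \<equiv> w1 - s' * w0"
  shows "(p - p') * (r - r') * (s - s') * tri e x0 x1 y0 y1 w0 w1 =
      l' * m' * n' * tri e 1 p 1 r 1 s - l' * m' * n * tri e 1 p 1 r 1 s'
    - l' * m * n' * tri e 1 p 1 r' 1 s + l' * m * n * tri e 1 p 1 r' 1 s'
    - l * m' * n' * tri e 1 p' 1 r 1 s + l * m' * n * tri e 1 p' 1 r 1 s'
    + l * m * n' * tri e 1 p' 1 r' 1 s - l * m * n * tri e 1 p' 1 r' 1 s'"
proof -
  have 1: "(s - s') * tri e x0 x1 y0 y1 w0 w1 = n' * tri e x0 x1 y0 y1 1 s - n * tri e x0 x1 y0 y1 1 s'" for x0 x1 y0 y1
    unfolding n_def n'_def by (rule tri_interpolate_w)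
  have 2: "(r - r') * tri e x0 x1 y0 y1 w0 w1 = m' * tri e x0 x1 1 r w0 w1 - m * tri e x0 x1 1 r' w0 w1" for x0 x1 w0 w1
    unfolding m_def m'_def by (rule tri_interpolate_y)
  have 3: "(p - p') * tri e x0 x1 y0 y1 w0 w1 = l' * tri e 1 p y0 y1 w0 w1 - l * tri e 1 p' y0 y1 w0 w1" for y0 y1 w0 w1
    unfolding l_def l'_def by (rule tri_interpolate_x)
  have "(p - p') * (r - r') * (s - s') * tri e x0 x1 y0 y1 w0 w1
    = (p - p') * ((r - r') * ((s - s') * tri e x0 x1 y0 y1 w0 w1))" by (simp only: mult.assoc)
  also have "\<dots> = (p - p') * (n' * ((r - r') * tri e x0 x1 y0 y1 1 s) - n * ((r - r') * tri e x0 x1 y0 y1 1 s'))"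
    unfolding 1 by (simp only: algebra_simps)
  also have "\<dots> = n' * m' * ((p - p') * tri e x0 x1 1 r 1 s) - n' * m * ((p - p') * tri e x0 x1 1 r' 1 s)
     - n * m' * ((p - p') * tri e x0 x1 1 r 1 s') + n * m * ((p - p') * tri e x0 x1 1 r' 1 s')"
    unfolding 2 by (simp only: algebra_simps)
  finally show ?thesis unfolding 3 by (simp add: algebra_simps)
qed

context cubic_field begin

text \<open>Functionals with coefficients in the closure, because the separating forms used later
  need not be defined over the original field.\<close>

definition ev :: "'a alg_closure ^ 8 \<Rightarrow> 'a ^ 8 \<Rightarrow> 'a alg_closure" where
  "ev e v = (\<Sum>i\<in>UNIV. e $ i * to_ac (v $ i))"

lemma ev_zero: "ev e 0 = 0" by (simp add: ev_def)

lemma ev_Lc: "ev e (Lc I f k) = (\<Sum>i\<in>I. to_ac (k i) * ev e (f i))"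
  unfolding ev_def Lc_def
  by (simp add: sum_component to_ac_sum sum_distrib_left mult.left_commute) (rule sum.swap)

fun X0 X1 :: "'a option \<Rightarrow> 'a alg_closure" where
  "X0 None = 0" | "X0 (Some t) = 1"
| "X1 None = 1" | "X1 (Some t) = to_ac t"

lemma frob_cubed_X [simp]: "\<sigma> (\<sigma> (\<sigma> (X0 s))) = X0 s" "\<sigma> (\<sigma> (\<sigma> (X1 s))) = X1 s"
  by (cases s; simp flip: to_ac_frob)+

lemma ev_pt: "ev e (pt s) = tri e (X0 s) (X1 s) (\<sigma> (X0 s)) (\<sigma> (X1 s)) (\<sigma> (\<sigma> (X0 s))) (\<sigma> (\<sigma> (X1 s)))"
  by (cases s) (simp_all add: ev_def sum_8 tri_def Pvec_nth nm_def flip: to_ac_frob)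

definition up :: "'a ^ 8 \<Rightarrow> 'a alg_closure ^ 8" where "up v = (\<chi> i. to_ac (v $ i))"

lemma ev_up: "ev (up v) w = to_ac (dot v w)"
  by (simp add: ev_def up_def dot_def to_ac_sum)

text \<open>Interpolation at the two zeros of the discriminant and their conjugates. The Frobenius
  map permutes the eight corners in an orbit of six, represented by f, and an orbit of two,
  represented by g. The values on the first orbit vanish, so only two products of linear forms
  remain.\<close>

lemma irreducible_form_split:
  assumes ad: "a \<in> Fq q" "d \<in> Fq q" and noroot: "\<And>t. Qf a b c d t \<noteq> 0"
    and noinf: "d * b \<noteq> \<sigma> c * \<sigma> (\<sigma> c)"
  obtains th th' g where "th' = \<sigma> (\<sigma> (\<sigma> th))" "th = \<sigma> (\<sigma> (\<sigma> th'))" "th \<noteq> th'" "\<sigma> (\<sigma> g) = g"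
    "\<And>x0 x1 y0 y1 w0 w1. (th - th') * \<sigma> (th - th') * \<sigma> (\<sigma> (th - th')) * tri (up (Pvec q a b c d)) x0 x1 y0 y1 w0 w1 =
       \<sigma> g * ((x1 - th * x0) * (y1 - \<sigma> th' * y0) * (w1 - \<sigma> (\<sigma> th) * w0))
       - g * ((x1 - th' * x0) * (y1 - \<sigma> th * y0) * (w1 - \<sigma> (\<sigma> th') * w0))"
proof -
  let ?\<tau> = "\<lambda>x :: 'a alg_closure. \<sigma> (\<sigma> (\<sigma> x))"
  define T where "T = tri (up (Pvec q a b c d))"
  define F where "F x y w = T 1 x 1 y 1 w" for x y w
  \<comment> \<open>Coefficients of \<open>Qf\<close> as a polynomial, so that it can be evaluated
    in the closure.\<close>
  define q2 q1 q0 where "q2 = d * b - \<sigma> c * \<sigma> (\<sigma> c)"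
    and "q1 = d * a + c * b - \<sigma> c * \<sigma> b - \<sigma> (\<sigma> b) * \<sigma> (\<sigma> c)" and "q0 = c * a - \<sigma> b * \<sigma> (\<sigma> b)"
  define Q where "Q x = to_ac q2 * x\<^sup>2 + to_ac q1 * x + to_ac q0" for x
  have sad: "\<sigma> (to_ac a) = to_ac a" "\<sigma> (to_ac d) = to_ac d" "\<And>x. ?\<tau> (to_ac x) = to_ac x"
    using ad by (simp_all add: Fq_iff flip: to_ac_frob)
  have F: "F x y w = to_ac a + to_ac b * x + \<sigma> (to_ac b) * y + \<sigma> (\<sigma> (to_ac b)) * w + to_ac c * (y * w)
      + \<sigma> (to_ac c) * (w * x) + \<sigma> (\<sigma> (to_ac c)) * (x * y) + to_ac d * (x * y * w)" for x y w
    by (simp add: F_def T_def tri_def up_def Pvec_nth algebra_simps)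
  have sF: "\<sigma> (F x y w) = F (\<sigma> w) (\<sigma> x) (\<sigma> y)" for x y w
    unfolding F by (simp add: sad algebra_simps)
  \<comment> \<open>For fixed x, F is bilinear in (1, y) and (1, w). The two by two determinant of
    its values is its discriminant times the two differences of nodes.\<close>
  have disc: "F x y w * F x y' w' - F x y w' * F x y' w = Q x * (y - y') * (w - w')" for x y w y' w'
    unfolding F Q_def q2_def q1_def q0_def by (simp add: algebra_simps power2_eq_square)
  have q2: "q2 \<noteq> 0" using noinf by (simp add: q2_def)
  have "\<exists>x. poly [:to_ac q0, to_ac q1, to_ac q2:] x = 0"
    by (rule alg_closed_imp_poly_has_root) (use q2 in simp)
  then obtain th where th: "Q th = 0" by (auto simp: Q_def algebra_simps power2_eq_square)
  define th' where "th' = ?\<tau> th"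
  have tQ: "?\<tau> (Q x) = Q (?\<tau> x)" for x
    by (simp add: Q_def sad)
  have th'0: "Q th' = 0" using tQ[of th] th by (simp add: th'_def)
  have "th \<notin> range to_ac"
  proof
    assume "th \<in> range to_ac"
    then obtain t where t: "th = to_ac t" by blast
    have "Q th = to_ac (Qf a b c d t)"
      unfolding Q_def t Qf_def q2_def q1_def q0_def by (simp add: algebra_simps power2_eq_square)
    then show False using th noroot by simp
  qed
  then have neq: "th \<noteq> th'" using frob_cubed_ac_iff[of th] by (auto simp: th'_def)
  have "to_ac q2 * (th + th') + to_ac q1 = 0"
  proof -
    have "(th - th') * (to_ac q2 * (th + th') + to_ac q1) = Q th - Q th'"
      by (simp add: Q_def algebra_simps power2_eq_square)
    then show ?thesis using neq th th'0 by simp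
  qed
  then have q1: "to_ac q1 = - to_ac q2 * (th + th')" by (simp add: eq_neg_iff_add_eq_0 add.commute)
  have q0: "to_ac q0 = to_ac q2 * th * th'"
    using th unfolding Q_def q1 by (simp add: algebra_simps power2_eq_square)
  have Q: "Q x = to_ac q2 * (x - th) * (x - th')" for x
    unfolding Q_def q1 q0 by (simp add: algebra_simps power2_eq_square)
  \<comment> \<open>The third power of the Frobenius map is injective and permutes the zeros of the
    quadratic Q, so it exchanges th and th'.\<close>
  have "?\<tau> th' \<noteq> th'" using neq by (simp add: th'_def)
  moreover have "Q (?\<tau> th') = 0" using tQ[of th'] th'0 by simp
  ultimately have tth': "?\<tau> th' = th" unfolding Q using q2 by simp
  define f where "f = F th (\<sigma> th) (\<sigma> (\<sigma> th))"
  define g where "g = F th (\<sigma> th') (\<sigma> (\<sigma> th))"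
  have f1: "F th' (\<sigma> th) (\<sigma> (\<sigma> th)) = \<sigma> f" by (simp add: f_def sF th'_def)
  have f2: "F th' (\<sigma> th') (\<sigma> (\<sigma> th)) = \<sigma> (\<sigma> f)" by (simp add: sF th'_def flip: f1)
  have f3: "F th' (\<sigma> th') (\<sigma> (\<sigma> th')) = ?\<tau> f" by (simp add: sF th'_def flip: f2)
  have f4: "F th (\<sigma> th') (\<sigma> (\<sigma> th')) = \<sigma> (?\<tau> f)" by (simp add: sF tth' flip: f3)
  have f5: "F th (\<sigma> th) (\<sigma> (\<sigma> th')) = \<sigma> (\<sigma> (?\<tau> f))" by (simp add: sF tth' flip: f4)
  have f6: "?\<tau> (?\<tau> f) = f" unfolding f_def f5[unfolded f_def, symmetric] by (simp add: sF tth')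
  have g1: "F th' (\<sigma> th) (\<sigma> (\<sigma> th')) = \<sigma> g" by (simp add: g_def sF th'_def)
  have g2: "\<sigma> (\<sigma> g) = g" unfolding g1[symmetric] by (simp add: g_def sF tth')
  \<comment> \<open>Since Q vanishes at th, so does the determinant \<open>disc\<close> on the four
    corners with first entry th.\<close>
  have r1: "f * \<sigma> (?\<tau> f) = \<sigma> (\<sigma> (?\<tau> f)) * g"
    using disc[of th "\<sigma> th" "\<sigma> (\<sigma> th)" "\<sigma> th'" "\<sigma> (\<sigma> th')"] th
    by (simp add: f4 f5 flip: f_def g_def)
  \<comment> \<open>If f were nonzero, \<open>r1\<close> and its conjugates would make N = f *
    f^(q^3) fixed by the Frobenius map and equal to g * \<sigma> g. Then the signed sum of corner
    products below, the polarisation of \<open>disc\<close> at th and th', would be 0. But it equals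
    -q2 (th - th')^2 times two nonzero differences.\<close>
  have f0: "f = 0"
  proof (rule ccontr)
    assume fn: "f \<noteq> 0"
    define N where "N = f * ?\<tau> f"
    have s1: "\<sigma> (f * \<sigma> (?\<tau> f)) = \<sigma> (\<sigma> (\<sigma> (?\<tau> f)) * g)" using r1 by simp
    then have s1: "\<sigma> f * \<sigma> (\<sigma> (?\<tau> f)) = f * \<sigma> g" by (simp add: f6)
    then have "\<sigma> (\<sigma> f * \<sigma> (\<sigma> (?\<tau> f))) = \<sigma> (f * \<sigma> g)" by simp
    then have s2: "\<sigma> (\<sigma> f) * f = \<sigma> f * g" by (simp add: f6 g2)
    have gg: "g * \<sigma> g = \<sigma> N"
    proof -
      have "\<sigma> (\<sigma> (?\<tau> f)) * f * (g * \<sigma> g) = (f * \<sigma> (?\<tau> f)) * (\<sigma> f * \<sigma> (\<sigma> (?\<tau> f)))"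
        using r1 s1 by (simp add: algebra_simps)
      also have "\<dots> = \<sigma> (\<sigma> (?\<tau> f)) * f * \<sigma> N" by (simp add: N_def)
      finally show ?thesis using fn by simp
    qed
    have NN: "\<sigma> (\<sigma> N) = \<sigma> N"
    proof -
      have "\<sigma> f * f * \<sigma> (\<sigma> N) = \<sigma> f * (\<sigma> (\<sigma> f) * f) * \<sigma> (\<sigma> (?\<tau> f))"
        by (simp add: N_def)
      also have "\<dots> = \<sigma> f * \<sigma> f * (\<sigma> (\<sigma> (?\<tau> f)) * g)" unfolding s2 by (simp only: ac_simps)
      also have "\<dots> = \<sigma> f * f * \<sigma> N" unfolding r1[symmetric] by (simp add: N_def)
      finally show ?thesis using fn by simp
    qed
    then have "\<sigma> N = N" using frob_eq_iff_ac by blast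
    have "F th (\<sigma> th) (\<sigma> (\<sigma> th)) * F th' (\<sigma> th') (\<sigma> (\<sigma> th')) + F th' (\<sigma> th) (\<sigma> (\<sigma> th)) * F th (\<sigma> th') (\<sigma> (\<sigma> th'))
       - F th (\<sigma> th) (\<sigma> (\<sigma> th')) * F th' (\<sigma> th') (\<sigma> (\<sigma> th)) - F th' (\<sigma> th) (\<sigma> (\<sigma> th')) * F th (\<sigma> th') (\<sigma> (\<sigma> th))
      = (2 * to_ac q2 * th * th' + to_ac q1 * (th + th') + 2 * to_ac q0) * (\<sigma> th - \<sigma> th') * (\<sigma> (\<sigma> th) - \<sigma> (\<sigma> th'))"
      unfolding F q2_def q1_def q0_def by (simp add: algebra_simps)
    also have "2 * to_ac q2 * th * th' + to_ac q1 * (th + th') + 2 * to_ac q0 = - to_ac q2 * (th - th') * (th - th')"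
      unfolding q1 q0 by (simp add: algebra_simps)
    also have "F th (\<sigma> th) (\<sigma> (\<sigma> th)) * F th' (\<sigma> th') (\<sigma> (\<sigma> th')) + F th' (\<sigma> th) (\<sigma> (\<sigma> th)) * F th (\<sigma> th') (\<sigma> (\<sigma> th'))
       - F th (\<sigma> th) (\<sigma> (\<sigma> th')) * F th' (\<sigma> th') (\<sigma> (\<sigma> th)) - F th' (\<sigma> th) (\<sigma> (\<sigma> th')) * F th (\<sigma> th') (\<sigma> (\<sigma> th))
      = N + \<sigma> N - \<sigma> (\<sigma> N) - g * \<sigma> g"
      unfolding f1 f2 f3 f4 f5 g1 f_def[symmetric] g_def[symmetric]
      by (simp add: N_def algebra_simps)
    finally show False using \<open>\<sigma> N = N\<close> gg neq q2 by simp
  qed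
  show ?thesis
  proof (rule that[of th' th g])
    show "th' = ?\<tau> th" "th = ?\<tau> th'" "th \<noteq> th'" "\<sigma> (\<sigma> g) = g"
      using th'_def tth' neq g2 by auto
    fix x0 x1 y0 y1 w0 w1
    have corners: "T 1 th 1 (\<sigma> th) 1 (\<sigma> (\<sigma> th)) = 0" "T 1 th' 1 (\<sigma> th) 1 (\<sigma> (\<sigma> th)) = 0"
      "T 1 th' 1 (\<sigma> th') 1 (\<sigma> (\<sigma> th)) = 0" "T 1 th' 1 (\<sigma> th') 1 (\<sigma> (\<sigma> th')) = 0"
      "T 1 th 1 (\<sigma> th') 1 (\<sigma> (\<sigma> th')) = 0" "T 1 th 1 (\<sigma> th) 1 (\<sigma> (\<sigma> th')) = 0"
      "T 1 th 1 (\<sigma> th') 1 (\<sigma> (\<sigma> th)) = g" "T 1 th' 1 (\<sigma> th) 1 (\<sigma> (\<sigma> th')) = \<sigma> g"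
      using f_def g_def f1 f2 f3 f4 f5 g1 f0 by (simp_all add: F_def)
    show "(th - th') * \<sigma> (th - th') * \<sigma> (\<sigma> (th - th')) * tri (up (Pvec q a b c d)) x0 x1 y0 y1 w0 w1 =
       \<sigma> g * ((x1 - th * x0) * (y1 - \<sigma> th' * y0) * (w1 - \<sigma> (\<sigma> th) * w0))
       - g * ((x1 - th' * x0) * (y1 - \<sigma> th * y0) * (w1 - \<sigma> (\<sigma> th') * w0))"
      unfolding frob_diff_ac
      by (subst tri_interpolate) (simp add: corners[unfolded T_def])
  qed
qed

end

section \<open>The zero set in the multiplicative coordinate\<close>

text \<open>Records the output of \<open>irreducible_form_split\<close> for a normal vector v of the
  hyperplane, together with the size of the zero set.\<close>

locale twisted_norm_form = cubic_field q ty
  for q :: nat and ty :: "'a::{field,finite} itself" +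
  fixes v :: "'a ^ 8" and th th' g :: "'a alg_closure"
  assumes v_U1: "v \<in> U1 q" and v_nz: "v \<noteq> 0"
    and th'_eq: "\<sigma> (\<sigma> (\<sigma> th)) = th'" and th_eq: "\<sigma> (\<sigma> (\<sigma> th')) = th" and th_neq: "th \<noteq> th'"
    and g_fixed: "\<sigma> (\<sigma> g) = g"
    and split: "(th - th') * \<sigma> (th - th') * \<sigma> (\<sigma> (th - th')) * tri (up v) x0 x1 y0 y1 w0 w1 =
       \<sigma> g * ((x1 - th * x0) * (y1 - \<sigma> th' * y0) * (w1 - \<sigma> (\<sigma> th) * w0))
       - g * ((x1 - th' * x0) * (y1 - \<sigma> th * y0) * (w1 - \<sigma> (\<sigma> th') * w0))"
    and card_zeros: "card {s. dot v (pt s) = 0} = q\<^sup>2 - q + 1"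
begin

definition Zs :: "'a option set" where "Zs = {s. dot v (pt s) = 0}"

definition L :: "'a option \<Rightarrow> 'a alg_closure" where "L s = X1 s - th * X0 s"

definition L' :: "'a option \<Rightarrow> 'a alg_closure" where "L' s = X1 s - th' * X0 s"

definition u :: "'a option \<Rightarrow> 'a alg_closure" where "u s = L s / L' s"

text \<open>One of the two products in \<open>split\<close>. The third Frobenius power exchanges
  \<open>L\<close> and \<open>L'\<close>, so the other product is \<sigma> of this one, and the form
  becomes \<sigma> (g * m) - g * m up to the factor \<open>D\<close>.\<close>

definition m :: "'a option \<Rightarrow> 'a alg_closure" where "m s = L' s * \<sigma> (L s) * \<sigma> (\<sigma> (L' s))"

definition D :: "'a alg_closure" where "D = (th - th') * \<sigma> (th - th') * \<sigma> (\<sigma> (th - th'))"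

lemma D_nz: "D \<noteq> 0" using th_neq by (simp add: D_def)

lemma frob_cubed_L [simp]: "\<sigma> (\<sigma> (\<sigma> (L s))) = L' s" "\<sigma> (\<sigma> (\<sigma> (L' s))) = L s"
  by (simp_all add: L_def L'_def th'_eq th_eq)

lemma L_nz [simp]: "L s \<noteq> 0"
proof (cases s)
  case (Some t)
  have "th \<notin> range (to_ac :: 'a \<Rightarrow> _)" using th'_eq th_neq frob_cubed_ac_iff[of th] by simp
  then show ?thesis using Some by (auto simp: L_def)
qed (simp add: L_def)

lemma L'_nz [simp]: "L' s \<noteq> 0"
  using L_nz[of s] frob_cubed_L(2)[of s] by (metis frob_zero)

lemma u_nz [simp]: "u s \<noteq> 0" and m_nz [simp]: "m s \<noteq> 0"
  by (simp_all add: u_def m_def)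

lemma frob_cubed_u: "\<sigma> (\<sigma> (\<sigma> (u s))) = inverse (u s)"
  by (simp add: u_def)

text \<open>u is a Moebius function of the parameter with determinant th - th'.\<close>

lemma inj_u: "u s = u s' \<Longrightarrow> s = s'"
proof -
  assume "u s = u s'"
  then have "L s * L' s' = L s' * L' s" by (simp add: u_def field_simps)
  then have "(th - th') * (X1 s * X0 s' - X1 s' * X0 s) = 0"
    unfolding L_def L'_def by (simp add: algebra_simps)
  then show "s = s'" using th_neq by (cases s; cases s') auto
qed

lemma D_dot: "D * to_ac (dot v (pt s)) = \<sigma> (g * m s) - g * m s"
  unfolding ev_up[symmetric] ev_pt D_def split by (simp add: m_def L_def L'_def th'_eq th_eq mult_ac)

lemma Zs_iff: "s \<in> Zs \<longleftrightarrow> \<sigma> (g * m s) = g * m s"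
  using D_dot[of s] D_nz by (simp add: Zs_def) (metis eq_iff_diff_eq_0 mult_eq_0_iff to_ac_eq_0_iff)

lemma card_Zs: "card Zs = q\<^sup>2 - q + 1"
  using card_zeros by (simp add: Zs_def)

text \<open>Otherwise the form would vanish at all q^3 + 1 points of the projective line.\<close>

lemma g_nz: "g \<noteq> 0"
proof
  assume "g = 0"
  then have "tri (up v) x0 x1 y0 y1 w0 w1 = 0" for x0 x1 y0 y1 w0 w1
    using split[of x0 x1 y0 y1 w0 w1] D_nz by (simp add: D_def)
  then have "Zs = UNIV" unfolding Zs_def ev_up[symmetric, THEN arg_cong[of _ _ of_ac]]
    using ev_pt[of "up v"] ev_up[of v] by auto
  then have "card (UNIV :: 'a option set) = q\<^sup>2 - q + 1" using card_Zs by simp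
  then have "q ^ 3 = q\<^sup>2 - q" using card_field by (simp add: card_UNIV_option)
  moreover have "q\<^sup>2 - q < q ^ 3" using q_ge by (simp add: power2_eq_square power3_eq_cube less_imp_diff_less)
  ultimately show False by simp
qed

definition \<kappa> :: "'a alg_closure" where "\<kappa> = g / \<sigma> g"

lemma \<kappa>_nz [simp]: "\<kappa> \<noteq> 0" using g_nz by (simp add: \<kappa>_def)

text \<open>The equation of the zero set after division by the denominators. It eliminates the
  second conjugate of u, so that on the zero set only u and \<sigma> u have to be handled.\<close>

lemma frob_frob_u: "s \<in> Zs \<Longrightarrow> \<sigma> (\<sigma> (u s)) = \<kappa> * \<sigma> (u s) / u s"
  unfolding Zs_iff using g_nz by (simp add: u_def m_def \<kappa>_def g_fixed field_simps)

lemma Zs_iff_power: "s \<in> Zs \<longleftrightarrow> u s ^ (q\<^sup>2 - q + 1) = \<kappa>"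
proof -
  have "u s ^ (q\<^sup>2 - q + 1) * \<sigma> (u s) = \<sigma> (\<sigma> (u s)) * u s"
  proof -
    have "q\<^sup>2 - q + 1 + q = q * q + 1" using q_ge by (simp add: power2_eq_square)
    then show ?thesis unfolding frob_def
      by (metis mult.commute power_add power_mult power_one_right)
  qed
  moreover have "s \<in> Zs \<longleftrightarrow> \<sigma> (\<sigma> (u s)) * u s = \<kappa> * \<sigma> (u s)"
    unfolding Zs_iff using g_nz by (auto simp: u_def m_def \<kappa>_def g_fixed field_simps)
  ultimately show ?thesis using u_nz[of s] by (metis frob_eq_0_iff mult_cancel_right)
qed

text \<open>The equation has room for at most q^2 - q + 1 roots, and by \<open>inj_u\<close> the
  points already supply that many. Hence every root comes from a point, which produces points with
  prescribed u.\<close>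

lemma u_image_Zs: "u ` Zs = {y. y ^ (q\<^sup>2 - q + 1) = \<kappa>}"
proof (rule card_seteq)
  define p where "p = Polynomial.monom 1 (q\<^sup>2 - q + 1) - [:\<kappa>:]"
  have "Polynomial.coeff p (q\<^sup>2 - q + 1) = 1" by (simp add: p_def)
  then have p0: "p \<noteq> 0" by auto
  have eq: "{y. y ^ (q\<^sup>2 - q + 1) = \<kappa>} = {y. poly p y = 0}" by (simp add: p_def poly_monom)
  show "finite {y. y ^ (q\<^sup>2 - q + 1) = \<kappa>}" unfolding eq by (rule poly_roots_finite[OF p0])
  have "Polynomial.degree p \<le> q\<^sup>2 - q + 1"
    unfolding p_def by (intro degree_diff_le) (auto simp: degree_monom_le)
  then show "card {y. y ^ (q\<^sup>2 - q + 1) = \<kappa>} \<le> card (u ` Zs)"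
    unfolding eq using card_poly_roots_bound[OF p0] card_Zs
    by (simp add: card_image inj_on_def inj_u)
  show "u ` Zs \<subseteq> {y. y ^ (q\<^sup>2 - q + 1) = \<kappa>}" using Zs_iff_power by auto
qed

text \<open>A linear relation between three points (1, u, u^q) makes (u2 - u1) / (u3 - u1) invariant
  under the Frobenius map; its third power turns each u into 1 / u, which forces u2 = u3.\<close>

lemma no_three_collinear:
  assumes "\<sigma> (\<sigma> (\<sigma> a)) = inverse a" "\<sigma> (\<sigma> (\<sigma> b)) = inverse b" "\<sigma> (\<sigma> (\<sigma> c)) = inverse c"
    and nz: "a \<noteq> 0" "b \<noteq> 0" "c \<noteq> 0" and neq: "a \<noteq> b" "a \<noteq> c" "b \<noteq> (c :: 'a alg_closure)"
  shows "(b - a) * \<sigma> (c - a) - \<sigma> (b - a) * (c - a) \<noteq> 0"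
proof
  assume rel: "(b - a) * \<sigma> (c - a) - \<sigma> (b - a) * (c - a) = 0"
  define k where "k = (b - a) / (c - a)"
  have "\<sigma> k = \<sigma> (b - a) / \<sigma> (c - a)" by (simp only: k_def frob_divide)
  also have "\<dots> = k" using rel neq by (simp add: k_def frac_eq_eq del: frob_diff_ac)
  finally have k: "\<sigma> k = k" .
  have eq: "b - a = k * (c - a)" using neq by (simp add: k_def)
  then have "\<sigma> (\<sigma> (\<sigma> (b - a))) = \<sigma> (\<sigma> (\<sigma> (k * (c - a))))" by simp
  then have "inverse b - inverse a = k * (inverse c - inverse a)" by (simp add: k assms(1-3))
  then have "(inverse b - inverse a) * (a * b * c) = k * (inverse c - inverse a) * (a * b * c)" by simp
  moreover have "(inverse b - inverse a) * (a * b * c) = (a - b) * c"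
    "(inverse c - inverse a) * (a * b * c) = (a - c) * b"
    using nz by (simp_all add: field_simps)
  ultimately have "(a - b) * c = k * (a - c) * b" by (simp only: mult.assoc)
  moreover have "a - b = k * (a - c)" using eq by (simp add: algebra_simps)
  ultimately have "(a - b) * c = (a - b) * b" by metis
  then show False using neq by simp
qed

section \<open>Any five points of the zero set are independent\<close>

definition isform :: "('a option \<Rightarrow> 'a alg_closure) \<Rightarrow> bool" where
  "isform h \<longleftrightarrow> (\<exists>e. \<forall>s. h s = ev e (pt s))"

lemma isform_add: "isform h \<Longrightarrow> isform h' \<Longrightarrow> isform (\<lambda>s. h s + h' s)"
proof -
  assume "isform h" "isform h'"
  then obtain e e' where "\<forall>s. h s = ev e (pt s)" "\<forall>s. h' s = ev e' (pt s)" by (auto simp: isform_def)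
  then show ?thesis unfolding isform_def
    by (intro exI[of _ "e + e'"]) (simp add: ev_def distrib_right sum.distrib)
qed

lemma isform_scale: "isform h \<Longrightarrow> isform (\<lambda>s. k * h s)"
proof -
  assume "isform h"
  then obtain e where "\<forall>s. h s = ev e (pt s)" by (auto simp: isform_def)
  then show ?thesis unfolding isform_def
    by (intro exI[of _ "k *s e"]) (simp add: ev_def sum_distrib_left mult.assoc)
qed

lemma isform_prod:
  "isform (\<lambda>s. (X1 s - a * X0 s) * (\<sigma> (X1 s) - b * \<sigma> (X0 s)) * (\<sigma> (\<sigma> (X1 s)) - c * \<sigma> (\<sigma> (X0 s))))"
  unfolding isform_def ev_pt tri_def
  by (intro exI[of _ "vector [- a * b * c, a * b, a * c, - a, b * c, - b, - c, 1]"] allI)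
    (simp only: vector_8, simp add: algebra_simps)

lemma isform_L:
  "A \<in> {L, L'} \<Longrightarrow> B \<in> {L, L'} \<Longrightarrow> C \<in> {L, L'} \<Longrightarrow> isform (\<lambda>s. A s * \<sigma> (B s) * \<sigma> (\<sigma> (C s)))"
  using isform_prod by (auto simp: L_def L'_def)

text \<open>The line \<open>l\<close> passes through the points (1, u, u^q) of s1 and s2, and
  \<open>l'\<close> does the same for the inverses of u at s3 and s4. On the zero set
  \<open>m\<close> times l u * l' (1 / u) agrees with a form, and \<open>no_three_collinear\<close>
  keeps it nonzero at s5.\<close>

lemma separating_form:
  assumes "s1 \<in> Zs" "s2 \<in> Zs" "s3 \<in> Zs" "s4 \<in> Zs" "s5 \<in> Zs" "distinct [s1, s2, s3, s4, s5]"
  obtains e where "ev e (pt s1) = 0" "ev e (pt s2) = 0" "ev e (pt s3) = 0" "ev e (pt s4) = 0"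
    "ev e (pt s5) \<noteq> 0"
proof -
  define c where "c = u s2 - u s1"
  define c' where "c' = inverse (u s4) - inverse (u s3)"
  define l where "l y = c * \<sigma> (y - u s1) - \<sigma> c * (y - u s1)" for y
  define l' where "l' y = c' * \<sigma> (y - inverse (u s3)) - \<sigma> c' * (y - inverse (u s3))" for y
  define A where "A = \<sigma> c * u s1 - c * \<sigma> (u s1)"
  define A' where "A' = \<sigma> c' * inverse (u s3) - c' * \<sigma> (inverse (u s3))"
  \<comment> \<open>With y = u s and z = \<sigma> y, the product l y * l' (1 / y) has nine
    monomials, three of them constant. Each monomial times \<open>m\<close> is a choice of
    \<open>L\<close> or \<open>L'\<close> in the three factors, up to the constant \<kappa> coming
    from \<open>frob_frob_u\<close>.\<close>
  define h where "h s = (A * A' + c * c' + \<sigma> c * \<sigma> c') * (L' s * \<sigma> (L s) * \<sigma> (\<sigma> (L' s)))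
     + A * c' * (L' s * \<sigma> (L' s) * \<sigma> (\<sigma> (L' s)))
     + (- A * \<sigma> c' / \<kappa>) * (L' s * \<sigma> (L' s) * \<sigma> (\<sigma> (L s)))
     + c * A' / \<kappa> * (L s * \<sigma> (L s) * \<sigma> (\<sigma> (L s)))
     + (- c * \<sigma> c' / \<kappa>) * (L' s * \<sigma> (L s) * \<sigma> (\<sigma> (L s)))
     + (- \<sigma> c * A') * (L s * \<sigma> (L s) * \<sigma> (\<sigma> (L' s)))
     + (- \<sigma> c * c') * (L s * \<sigma> (L' s) * \<sigma> (\<sigma> (L' s)))" for s
  have "isform h" unfolding h_def by (intro isform_add isform_scale isform_L) auto
  then obtain e where e: "\<And>s. h s = ev e (pt s)" by (auto simp: isform_def)
  have h: "h s = m s * (l (u s) * l' (inverse (u s)))" if s: "s \<in> Zs" for s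
  proof -
    let ?y = "u s" and ?z = "\<sigma> (u s)"
    have L: "L s = u s * L' s" by (simp add: u_def)
    have zz: "\<sigma> (\<sigma> (L s)) = \<kappa> * ?z / ?y * \<sigma> (\<sigma> (L' s))"
      by (subst L) (simp add: frob_frob_u[OF s])
    have z: "\<sigma> (L' s) = \<sigma> (L s) / ?z" by (simp add: u_def)
    have "h s = m s * (A * A' + c * c' + \<sigma> c * \<sigma> c' + A * c' / ?z - A * \<sigma> c' / ?y + c * A' * ?z
      - c * \<sigma> c' * (?z / ?y) - \<sigma> c * A' * ?y - \<sigma> c * c' * (?y / ?z))"
    proof -
      define p r t y z where pr: "p = L' s" "r = \<sigma> (L s)" "t = \<sigma> (\<sigma> (L' s))" "y = u s" "z = \<sigma> (u s)"
      have nz: "y \<noteq> 0" "z \<noteq> 0" "\<kappa> \<noteq> 0" by (simp_all add: pr)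
      have "h s = (A * A' + c * c' + \<sigma> c * \<sigma> c') * (p * r * t)
        + A * c' * (p * (r / z) * t)
        + (- A * \<sigma> c' / \<kappa>) * (p * (r / z) * (\<kappa> * z / y * t))
        + c * A' / \<kappa> * (y * p * r * (\<kappa> * z / y * t))
        + (- c * \<sigma> c' / \<kappa>) * (p * r * (\<kappa> * z / y * t))
        + (- \<sigma> c * A') * (y * p * r * t)
        + (- \<sigma> c * c') * (y * p * (r / z) * t)"
        unfolding h_def zz pr z[symmetric] L[symmetric] ..
      also have "\<dots> = p * r * t * (A * A' + c * c' + \<sigma> c * \<sigma> c' + A * c' / z - A * \<sigma> c' / y + c * A' * z
        - c * \<sigma> c' * (z / y) - \<sigma> c * A' * y - \<sigma> c * c' * (y / z))"
      proof -
        have "A * c' * (p * (r / z) * t) = p * r * t * (A * c' / z)"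
          "(- A * \<sigma> c' / \<kappa>) * (p * (r / z) * (\<kappa> * z / y * t)) = p * r * t * - (A * \<sigma> c' / y)"
          "c * A' / \<kappa> * (y * p * r * (\<kappa> * z / y * t)) = p * r * t * (c * A' * z)"
          "(- c * \<sigma> c' / \<kappa>) * (p * r * (\<kappa> * z / y * t)) = p * r * t * - (c * \<sigma> c' * (z / y))"
          "(- \<sigma> c * A') * (y * p * r * t) = p * r * t * - (\<sigma> c * A' * y)"
          "(- \<sigma> c * c') * (y * p * (r / z) * t) = p * r * t * - (\<sigma> c * c' * (y / z))"
          "(A * A' + c * c' + \<sigma> c * \<sigma> c') * (p * r * t) = p * r * t * (A * A' + c * c' + \<sigma> c * \<sigma> c')"
          using nz by (simp_all add: mult_ac)
        then show ?thesis by (simp only: distrib_left[symmetric] diff_conv_add_uminus)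
      qed
      finally show ?thesis unfolding pr m_def .
    qed
    also have "\<dots> = m s * ((A + c * ?z - \<sigma> c * ?y) * (A' + c' / ?z - \<sigma> c' / ?y))"
    proof (rule arg_cong[where f = "\<lambda>x. m s * x"])
      define y z where yz: "y = u s" "z = \<sigma> (u s)"
      have nz: "y \<noteq> 0" "z \<noteq> 0" by (simp_all add: yz)
      have "A * A' + c * c' + \<sigma> c * \<sigma> c' + A * c' / z - A * \<sigma> c' / y + c * A' * z
        - c * \<sigma> c' * (z / y) - \<sigma> c * A' * y - \<sigma> c * c' * (y / z)
        = (A + c * z - \<sigma> c * y) * (A' + c' / z - \<sigma> c' / y)"
      proof -
        have "(A + Z - Y) * (A' + P - R) = A * A' + Z * P + Y * R + A * P - A * R + Z * A' - Z * R - Y * A' - Y * P"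
          for Z Y P R by (simp add: algebra_simps)
        moreover have "c * z * (c' / z) = c * c'" "\<sigma> c * y * (\<sigma> c' / y) = \<sigma> c * \<sigma> c'"
          "c * z * A' = c * A' * z" "\<sigma> c * y * A' = \<sigma> c * A' * y"
          "c * z * (\<sigma> c' / y) = c * \<sigma> c' * (z / y)" "\<sigma> c * y * (c' / z) = \<sigma> c * c' * (y / z)"
          "A * (c' / z) = A * c' / z" "A * (\<sigma> c' / y) = A * \<sigma> c' / y"
          using nz by simp_all
        ultimately show ?thesis by presburger
      qed
      then show "A * A' + c * c' + \<sigma> c * \<sigma> c' + A * c' / ?z - A * \<sigma> c' / ?y + c * A' * ?z
        - c * \<sigma> c' * (?z / ?y) - \<sigma> c * A' * ?y - \<sigma> c * c' * (?y / ?z)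
        = (A + c * ?z - \<sigma> c * ?y) * (A' + c' / ?z - \<sigma> c' / ?y)" unfolding yz .
    qed
    also have "A + c * ?z - \<sigma> c * ?y = l ?y" by (simp add: A_def l_def algebra_simps)
    also have "A' + c' / ?z - \<sigma> c' / ?y = l' (inverse ?y)" by (simp add: A'_def l'_def field_simps)
    finally show ?thesis .
  qed
  have "l (u s5) \<noteq> 0" unfolding l_def c_def
    by (rule no_three_collinear) (use assms inj_u in \<open>auto simp: frob_cubed_u\<close>)
  \<comment> \<open>The hypotheses of \<open>no_three_collinear\<close> are stable under inversion,
    so it applies to the inverses as well.\<close>
  moreover have "l' (inverse (u s5)) \<noteq> 0" unfolding l'_def c'_def
    by (rule no_three_collinear) (use assms inj_u in \<open>auto simp: frob_cubed_u\<close>)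
  ultimately have "h s5 \<noteq> 0" using h assms by simp
  moreover have "l (u s1) = 0" "l (u s2) = 0" "l' (inverse (u s3)) = 0" "l' (inverse (u s4)) = 0"
    by (simp_all add: l_def l'_def c_def c'_def)
  then have "h s1 = 0" "h s2 = 0" "h s3 = 0" "h s4 = 0"
    using h assms by simp_all
  ultimately show ?thesis using that[of e] by (simp add: e)
qed

text \<open>A functional that kills four of the five points isolates, in any relation, the
  coefficient of the fifth.\<close>

lemma indep_5:
  assumes "I \<subseteq> Zs" "card I = 5"
  shows "indep I pt"
  unfolding indep_def
proof (intro allI impI ballI)
  fix k s assume k: "(\<forall>i\<in>I. k i \<in> Fq q) \<and> Lc I pt k = 0" and s: "s \<in> I"
  have "card (I - {s}) = 4" using assms s by simp
  then obtain xs where xs: "set xs = I - {s}" "length xs = 4" "distinct xs"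
    by (metis distinct_card finite finite_distinct_list)
  then obtain s1 s2 s3 s4 where xs': "xs = [s1, s2, s3, s4]"
    by (auto simp: numeral_eq_Suc length_Suc_conv)
  have I: "I = {s, s1, s2, s3, s4}" using xs s xs' by auto
  have dist: "distinct [s1, s2, s3, s4, s]" using xs xs' by auto
  obtain e where e: "ev e (pt s1) = 0" "ev e (pt s2) = 0" "ev e (pt s3) = 0" "ev e (pt s4) = 0"
    "ev e (pt s) \<noteq> 0"
    using separating_form[OF _ _ _ _ _ dist] assms(1) I by blast
  have "0 = ev e (Lc I pt k)" using k by (simp add: ev_zero)
  also have "\<dots> = to_ac (k s) * ev e (pt s)"
  proof -
    have "distinct [s, s1, s2, s3, s4]" using dist by auto
    then show ?thesis unfolding ev_Lc I using e by simp
  qed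
  finally show "k s = 0" using e by simp
qed

lemma indep_le_5:
  assumes "I \<subseteq> Zs" "card I \<le> 5"
  shows "indep I pt"
proof -
  \<comment> \<open>There are at least 13 zeros, so a smaller set can be completed to five
    points.\<close>
  have "4 * (4 - 1) \<le> q * (q - 1)" using q_ge by (intro mult_le_mono) auto
  then have "5 \<le> card Zs" unfolding card_Zs by (simp add: power2_eq_square algebra_simps)
  then obtain J where J: "I \<subseteq> J" "J \<subseteq> Zs" "card J = 5"
    using exists_subset_between[of I 5 Zs] assms by auto
  have J5: "indep J pt" using indep_5 J by blast
  show ?thesis unfolding indep_def
  proof (intro allI impI ballI)
    fix k i assume k: "(\<forall>i\<in>I. k i \<in> Fq q) \<and> Lc I pt k = 0" and i: "i \<in> I"
    have "Lc J pt (\<lambda>i. if i \<in> I then k i else 0) = Lc I pt k"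
      unfolding Lc_def using J by (intro sum.mono_neutral_cong_right) auto
    then have "(if i \<in> I then k i else 0) = 0"
      using indepD[OF J5, of "\<lambda>i. if i \<in> I then k i else 0" i] k i J by auto
    then show "k i = 0" using i by simp
  qed
qed

section \<open>Corner expansion on the zero set, and the span of the points\<close>

definition corner :: "'a alg_closure ^ 8 \<Rightarrow> 'a alg_closure \<Rightarrow> 'a alg_closure \<Rightarrow> 'a alg_closure \<Rightarrow> 'a alg_closure" where
  "corner e x y w = tri e 1 x 1 (\<sigma> y) 1 (\<sigma> (\<sigma> w))"

text \<open>The interpolation formula for an arbitrary form, rewritten in u. All eight terms share
  the factor \<open>m\<close>; what remains are u, \<sigma> u, their inverses, their two quotients,
  and twice the constant 1. It serves for the span and again for the relation at q = 4.\<close>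

lemma ev_corners:
  assumes s: "s \<in> Zs"
  shows "D * ev e (pt s) = m s * (corner e th th th * inverse (\<sigma> (u s)) - \<kappa> * corner e th th th' * inverse (u s)
    - corner e th th' th + \<kappa> * corner e th th' th' * (\<sigma> (u s) * inverse (u s))
    - corner e th' th th * (u s * inverse (\<sigma> (u s))) + \<kappa> * corner e th' th th'
    + corner e th' th' th * u s - \<kappa> * corner e th' th' th' * \<sigma> (u s))"
proof -
  define p r t y z where pr: "p = L' s" "r = \<sigma> (L' s)" "t = \<sigma> (\<sigma> (L' s))" "y = u s" "z = \<sigma> (u s)"
  have nz: "y \<noteq> 0" "z \<noteq> 0" by (simp_all add: pr)
  have L: "L s = y * p" by (simp add: pr u_def)
  have L1: "\<sigma> (L s) = z * r" unfolding L by (simp add: pr)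
  have L2: "\<sigma> (\<sigma> (L s)) = \<kappa> * z / y * t" unfolding L by (simp add: pr frob_frob_u[OF s])
  have m: "m s = p * (z * r) * t" unfolding m_def L1 by (simp add: pr)
  have "D * ev e (pt s) =
      p * r * t * corner e th th th - p * r * \<sigma> (\<sigma> (L s)) * corner e th th th'
    - p * \<sigma> (L s) * t * corner e th th' th + p * \<sigma> (L s) * \<sigma> (\<sigma> (L s)) * corner e th th' th'
    - L s * r * t * corner e th' th th + L s * r * \<sigma> (\<sigma> (L s)) * corner e th' th th'
    + L s * \<sigma> (L s) * t * corner e th' th' th - L s * \<sigma> (L s) * \<sigma> (\<sigma> (L s)) * corner e th' th' th'"
    unfolding ev_pt D_def frob_diff_ac corner_def pr
    by (subst tri_interpolate) (simp add: L_def L'_def)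
  also have "\<dots> = m s * (corner e th th th * inverse z - \<kappa> * corner e th th th' * inverse y
    - corner e th th' th + \<kappa> * corner e th th' th' * (z * inverse y)
    - corner e th' th th * (y * inverse z) + \<kappa> * corner e th' th th'
    + corner e th' th' th * y - \<kappa> * corner e th' th' th' * z)"
  proof -
    have "p * r * t * k = m s * (k * inverse z)" "p * r * \<sigma> (\<sigma> (L s)) * k = m s * (\<kappa> * k * inverse y)"
      "p * \<sigma> (L s) * t * k = m s * k" "p * \<sigma> (L s) * \<sigma> (\<sigma> (L s)) * k = m s * (\<kappa> * k * (z * inverse y))"
      "L s * r * t * k = m s * (k * (y * inverse z))" "L s * r * \<sigma> (\<sigma> (L s)) * k = m s * (\<kappa> * k)"
      "L s * \<sigma> (L s) * t * k = m s * (k * y)" "L s * \<sigma> (L s) * \<sigma> (\<sigma> (L s)) * k = m s * (\<kappa> * k * z)" for k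
      unfolding L2 unfolding L1 m unfolding L using nz by (simp_all add: divide_simps)
    then show ?thesis by (simp only: distrib_left right_diff_distrib)
  qed
  finally show ?thesis by (simp only: pr)
qed

text \<open>A nonzero coordinate of v either lies in \<open>Fq\<close> or has its conjugate as
  another coordinate. Comparing with the coordinates of k *s v shows that k is fixed by the
  Frobenius map.\<close>

lemma smult_in_U1:
  assumes "k *s v \<in> U1 q"
  shows "k \<in> Fq q"
proof -
  obtain a b c d where v: "v = Pvec q a b c d" "a \<in> Fq q" "d \<in> Fq q" using v_U1 by (auto simp: U1_def)
  obtain a' b' c' d' where v': "k *s v = Pvec q a' b' c' d'" "a' \<in> Fq q" "d' \<in> Fq q"
    using assms by (auto simp: U1_def)
  have "(k *s v) $ i = (Pvec q a' b' c' d') $ i" for i unfolding v' ..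
  then have eqs: "k * a = a'" "k * b = b'" "k * \<sigma> b = \<sigma> b'" "k * c = c'" "k * \<sigma> c = \<sigma> c'" "k * d = d'"
    unfolding v vector_smult_component by (metis Pvec_nth)+
  consider "a \<noteq> 0" | "b \<noteq> 0" | "c \<noteq> 0" | "d \<noteq> 0" using v_nz v Pvec_zero by force
  then show ?thesis
  proof cases
    case 1
    then have "k = a' / a" using eqs by auto
    then show ?thesis using v v' by (auto intro: Fq_divide)
  next
    case 2
    then show ?thesis using eqs unfolding Fq_iff by (metis frob_eq_0_iff frob_mult mult_cancel_right)
  next
    case 3
    then show ?thesis using eqs unfolding Fq_iff by (metis frob_eq_0_iff frob_mult mult_cancel_right)
  next
    case 4
    then have "k = d' / d" using eqs by auto
    then show ?thesis using v v' by (auto intro: Fq_divide)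
  qed
qed

text \<open>Restricted to the zero set, a form becomes a polynomial in u of degree at most 2q + 1,
  which is less than the number of zeros.\<close>

lemma form_vanishing_on_Zs:
  assumes a: "a \<in> U1 q" and zero: "\<And>s. s \<in> Zs \<Longrightarrow> dot a (pt s) = 0"
  shows "\<exists>k\<in>Fq q. a = k *s v"
proof -
  define C where "C = corner (up a)"
  \<comment> \<open>The expansion of \<open>ev_corners\<close> without the factor \<open>m\<close>,
    multiplied by u * \<sigma> u = u^(q + 1) to clear denominators; its two constant terms merge at
    the exponent q + 1.\<close>
  define p where "p = Polynomial.monom (C th th th) 1 - Polynomial.monom (\<kappa> * C th th th') q
    + Polynomial.monom (\<kappa> * C th' th th' - C th th' th) (q + 1) + Polynomial.monom (\<kappa> * C th th' th') (2 * q)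
    - Polynomial.monom (C th' th th) 2 + Polynomial.monom (C th' th' th) (q + 2)
    - Polynomial.monom (\<kappa> * C th' th' th') (2 * q + 1)"
  have roots: "poly p (u s) = 0" if s: "s \<in> Zs" for s
  proof -
    let ?y = "u s" and ?z = "\<sigma> (u s)"
    have nz: "?y \<noteq> 0" "?z \<noteq> 0" by simp_all
    have "ev (up a) (pt s) = 0" using zero[OF s] by (simp add: ev_up)
    then have E: "C th th th * inverse ?z - \<kappa> * C th th th' * inverse ?y
      - C th th' th + \<kappa> * C th th' th' * (?z * inverse ?y)
      - C th' th th * (?y * inverse ?z) + \<kappa> * C th' th th'
      + C th' th' th * ?y - \<kappa> * C th' th' th' * ?z = 0" (is "?E = 0")
      using ev_corners[OF s, of "up a"] by (simp add: C_def)
    have "poly p ?y = C th th th * ?y - \<kappa> * C th th th' * ?z + (\<kappa> * C th' th th' - C th th' th) * (?y * ?z)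
      + \<kappa> * C th th' th' * ?z\<^sup>2 - C th' th th * ?y\<^sup>2 + C th' th' th * (?y\<^sup>2 * ?z) - \<kappa> * C th' th' th' * (?y * ?z\<^sup>2)"
      unfolding p_def
      by (simp add: poly_monom frob_def power_add power_mult power2_eq_square mult_ac power_mult_distrib mult_2)
    also have "\<dots> = ?y * ?z * ?E"
    proof -
      have "y * z * (a1 * inverse z - a2 * inverse y - a3 + a4 * (z * inverse y) - a5 * (y * inverse z) + a6 + a7 * y - a8 * z)
        = a1 * y - a2 * z + (a6 - a3) * (y * z) + a4 * z\<^sup>2 - a5 * y\<^sup>2 + a7 * (y\<^sup>2 * z) - a8 * (y * z\<^sup>2)"
        if "y \<noteq> 0" "z \<noteq> 0" for y z a1 a2 a3 a4 a5 a6 a7 a8 :: "'a alg_closure"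
      proof -
        have *: "y * z * (a1 * inverse z) = a1 * y" "y * z * (a2 * inverse y) = a2 * z"
          "y * z * (a4 * (z * inverse y)) = a4 * z\<^sup>2" "y * z * (a5 * (y * inverse z)) = a5 * y\<^sup>2"
          using that by (simp_all add: field_simps power2_eq_square)
        show ?thesis unfolding distrib_left right_diff_distrib *
          by (simp add: algebra_simps power2_eq_square)
      qed
      from this[OF nz] show ?thesis by simp
    qed
    finally show ?thesis unfolding E by simp
  qed
  have "p = 0"
  proof (rule ccontr)
    assume p0: "p \<noteq> 0"
    have "Polynomial.degree p \<le> 2 * q + 1" unfolding p_def using q_ge
      by (intro degree_add_le degree_diff_le) (auto intro!: order.trans[OF degree_monom_le])
    then have "card {y. poly p y = 0} \<le> 2 * q + 1" using card_poly_roots_bound[OF p0] by simp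
    moreover have "card (u ` Zs) \<le> card {y. poly p y = 0}"
      using roots poly_roots_finite[OF p0] by (intro card_mono) auto
    moreover have "card (u ` Zs) = q\<^sup>2 - q + 1" using card_Zs by (simp add: card_image inj_on_def inj_u)
    \<comment> \<open>This puts 2 q + 1 below q^2 - q + 1.\<close>
    moreover have "3 * q < q * q" using q_ge by simp
    ultimately show False by (simp add: power2_eq_square)
  qed
  then have coeff: "Polynomial.coeff p n = 0" for n by simp
  \<comment> \<open>The seven exponents are distinct because q is at least 4, so every coefficient
    vanishes. Only the two mixed corners survive, in the same ratio as for v.\<close>
  have C0: "C th th th = 0" "C th th th' = 0" "C th th' th' = 0" "C th' th th = 0" "C th' th' th = 0"
      "C th' th' th' = 0" "\<kappa> * C th' th th' = C th th' th"
    using coeff[of 1] coeff[of q] coeff[of "2 * q"] coeff[of 2] coeff[of "q + 2"] coeff[of "2 * q + 1"]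
      coeff[of "q + 1"] q_ge
    unfolding p_def by auto
  define k where "k = C th' th th' / \<sigma> g"
  have tri: "tri (up a) x0 x1 y0 y1 w0 w1 = k * tri (up v) x0 x1 y0 y1 w0 w1" for x0 x1 y0 y1 w0 w1
  proof -
    have "D * tri (up a) x0 x1 y0 y1 w0 w1 =
       C th' th th' * ((x1 - th * x0) * (y1 - \<sigma> th' * y0) * (w1 - \<sigma> (\<sigma> th) * w0))
       - C th th' th * ((x1 - th' * x0) * (y1 - \<sigma> th * y0) * (w1 - \<sigma> (\<sigma> th') * w0))"
      unfolding D_def frob_diff_ac
      by (subst tri_interpolate) (simp add: C0[unfolded C_def corner_def] C_def corner_def)
    also have "\<dots> = k * (D * tri (up v) x0 x1 y0 y1 w0 w1)"
    proof -
      have "c * P - g / \<sigma> g * c * R = c / \<sigma> g * (\<sigma> g * P - g * R)" for c P R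
        using g_nz by (simp add: field_simps)
      then show ?thesis unfolding D_def split C0(7)[symmetric] k_def \<kappa>_def by blast
    qed
    finally have "D * tri (up a) x0 x1 y0 y1 w0 w1 = D * (k * tri (up v) x0 x1 y0 y1 w0 w1)"
      by (simp only: mult.left_commute)
    then show ?thesis using D_nz by simp
  qed
  have nth: "to_ac (a $ i) = k * to_ac (v $ i)" for i
  proof -
    have "\<forall>i. up a $ i = k * up v $ i" unfolding forall_8
      using tri[of 1 0 1 0 1 0] tri[of 1 0 1 0 0 1] tri[of 1 0 0 1 1 0] tri[of 1 0 0 1 0 1]
        tri[of 0 1 1 0 1 0] tri[of 0 1 1 0 0 1] tri[of 0 1 0 1 1 0] tri[of 0 1 0 1 0 1]
      by (simp add: tri_def)
    then show ?thesis by (simp add: up_def)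
  qed
  obtain i where i: "v $ i \<noteq> 0" using v_nz by (auto simp: vec_eq_iff)
  \<comment> \<open>The factor descends to the field as a quotient of coordinates of a and
    v.\<close>
  define k0 where "k0 = a $ i / v $ i"
  have "k = to_ac k0" using nth[of i] i by (simp add: k0_def)
  then have "to_ac (a $ j) = to_ac (k0 * v $ j)" for j using nth by simp
  then have "a = k0 *s v" by (simp add: vec_eq_iff del: to_ac_mult)
  then show ?thesis using smult_in_U1 a by blast
qed

definition H :: "('a ^ 8) set" where "H = {w \<in> U1 q. dot v w = 0}"

lemma fsubspace_H: "fsubspace q H"
  using fsubspace_U1 by (auto simp: H_def fsubspace_def dot_add dot_smult dot_zero)

lemma pt_in_H: "pt s \<in> H \<longleftrightarrow> s \<in> Zs"
  by (simp add: H_def Zs_def pt_in_U1)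

lemma card_H_le: "card H \<le> q ^ 7"
proof -
  obtain w where "w \<in> U1 q" "dot v w \<noteq> 0" using dot_nondegenerate[OF v_U1 v_nz] by blast
  then have "H \<subset> U1 q" unfolding H_def by blast
  then have "card H < card (U1 q :: ('a ^ 8) set)" by (rule psubset_card_mono[OF finite])
  then have "q ^ fdim q H < q ^ 8" unfolding card_U1 card_fsubspace[OF fsubspace_H] .
  then have "fdim q H < 8" using q_ge by (simp add: power_strict_increasing_iff)
  then show ?thesis unfolding card_fsubspace[OF fsubspace_H] using q_ge by (simp add: power_increasing)
qed

text \<open>By \<open>form_vanishing_on_Zs\<close> only the multiples of v by \<open>Fq\<close> are
  orthogonal to the span. So the span has at least q^7 elements, and H has no more.\<close>

lemma fspan_Zs: "fspan q (pt ` Zs) = H"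
proof -
  let ?A = "fspan q (pt ` Zs)"
  have sub: "?A \<subseteq> H" using pt_in_H by (intro fspan_least fsubspace_H) auto
  have "perp ?A \<subseteq> (\<lambda>k. k *s v) ` Fq q"
    unfolding perp_fspan unfolding perp_def using form_vanishing_on_Zs by auto
  then have "card (perp ?A) \<le> card ((\<lambda>k. k *s v) ` Fq q)" by (intro card_mono) auto
  also have "\<dots> \<le> q" using card_image_le[of "Fq q :: 'a set" "\<lambda>k. k *s v"] card_Fq by simp
  finally have "card (perp ?A) \<le> q" .
  moreover have "q ^ 8 \<le> card ?A * card (perp ?A)"
    using card_perp_subspace_ge[OF fsubspace_fspan, of "pt ` Zs"] sub
    unfolding card_fsubspace[OF fsubspace_fspan] H_def by blast
  ultimately have "q ^ 8 \<le> card ?A * q" by (meson mult_le_mono2 order_trans)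
  moreover have "q ^ 8 = q ^ 7 * q" using power_Suc2[of q 7] by simp
  ultimately have "q ^ 7 * q \<le> card ?A * q" by simp
  then have "card H \<le> card ?A" using card_H_le q_ge by simp
  then show ?thesis using sub by (intro card_seteq) auto
qed

end

section \<open>Six dependent points\<close>

text \<open>Compares the bound \<open>card_H_le\<close> with the number of combinations of three
  points with nonzero coefficients. With n + 3 = q^2 - q + 1 the factor n + 2 is q (q - 1), and
  cancelling q leaves 6 q^6 < (n + 3) (n + 1) (q - 1)^4.\<close>

lemma packing_bound:
  assumes "5 \<le> (q::nat)"
  shows "q ^ 7 < ((q\<^sup>2 - q + 1) choose 3) * (q - 1) ^ 3"
proof -
  obtain k where k: "q = k + 5" using assms by (metis add.commute le_Suc_ex)
  define n where "n = k * k + 9 * k + 18"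
  have n: "q\<^sup>2 - q + 1 = Suc (Suc (Suc n))" by (simp add: k n_def power2_eq_square algebra_simps)
  have c3: "6 * (Suc (Suc (Suc n)) choose 3) = (n + 3) * (n + 2) * (n + 1)"
  proof -
    have "(Suc (Suc (Suc n)) choose 3) * 3 = (n + 3) * (Suc (Suc n) choose 2)"
      using Suc_times_binomial_eq[of "Suc (Suc n)" 2, symmetric] by (simp only: Suc_numeral) (simp add: algebra_simps)
    moreover have "(Suc (Suc n) choose 2) * 2 = (n + 2) * (n + 1)"
      using Suc_times_binomial_eq[of "Suc n" 1, symmetric] by (simp only: Suc_1 choose_one) simp
    moreover have "6 * A = (n + 3) * (n + 2) * (n + 1)" if "A * 3 = (n + 3) * B" "B * 2 = (n + 2) * (n + 1)" for A B
    proof -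
      have "6 * A = 2 * (A * 3)" by simp
      also have "\<dots> = (n + 3) * (B * 2)" unfolding that(1) by simp
      finally show ?thesis unfolding that(2) by (simp only: mult.assoc)
    qed
    ultimately show ?thesis by blast
  qed
  have "6 * (k + 5) ^ 6 < (n + 3) * (n + 1) * (k + 4) ^ 4"
  proof -
    \<comment> \<open>Here a = q - 1 and b = q. From 4 b \<le> 5 a and 4 \<le> a follows 4096 b^6
      \<le> 625 a^6 b^2, and 4096 / 625 exceeds 6 by enough to absorb the lower term a^4.\<close>
    define a b where ab: "a = k + 4" "b = k + 5"
    have "(4 * b) ^ 4 \<le> (5 * a) ^ 4" by (rule power_mono) (auto simp: ab)
    then have 1: "256 * b ^ 4 \<le> 625 * a ^ 4" by (simp add: power_mult_distrib)
    have 2: "16 \<le> a ^ 2" using power_mono[of 4 a 2] by (simp add: ab)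
    have "256 * b ^ 4 * 16 * b ^ 2 \<le> 625 * a ^ 4 * a ^ 2 * b ^ 2"
      by (rule mult_le_mono[OF mult_le_mono[OF 1 2] order_refl])
    moreover have "b ^ 4 * b ^ 2 = b ^ 6" by (simp flip: power_add)
    moreover have "a ^ 4 * 25 \<le> b ^ 4 * b ^ 2"
      using power_mono[of 5 b 2] by (intro mult_le_mono power_mono) (simp_all add: ab)
    moreover have "(n + 3) * (n + 1) + 1 = a ^ 2 * b ^ 2"
      by (simp add: n_def ab power2_eq_square algebra_simps)
    then have "((n + 3) * (n + 1) + 1) * a ^ 4 = a ^ 4 * a ^ 2 * b ^ 2" by (simp only: mult_ac)
    then have "(n + 3) * (n + 1) * a ^ 4 + a ^ 4 = a ^ 4 * a ^ 2 * b ^ 2" by (simp only: distrib_right mult_1)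
    moreover have "0 < b ^ 6" by (simp add: ab)
    ultimately have "6 * b ^ 6 < (n + 3) * (n + 1) * a ^ 4" by linarith
    then show ?thesis by (simp only: ab)
  qed
  then have "6 * (k + 5) ^ 6 * (k + 5) < (n + 3) * (n + 1) * (k + 4) ^ 4 * (k + 5)"
    by (rule mult_strict_right_mono) simp
  then have "6 * (k + 5) ^ 7 < (n + 3) * (n + 1) * (k + 4) ^ 4 * (k + 5)"
    using power_Suc2[of "k + 5" 6] by (simp add: mult_ac)
  also have "\<dots> = (n + 3) * (n + 2) * (n + 1) * (k + 4) ^ 3"
  proof -
    have "n + 2 = (k + 4) * (k + 5)" by (simp add: n_def algebra_simps)
    moreover have "(k + 4) ^ 4 = (k + 4) * (k + 4) ^ 3" using power_Suc[of "k + 4" 3] by simp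
    ultimately show ?thesis by (simp only: mult_ac)
  qed
  also have "\<dots> = 6 * ((Suc (Suc (Suc n)) choose 3) * (k + 4) ^ 3)" unfolding c3[symmetric] by simp
  finally have "(k + 5) ^ 7 < (Suc (Suc (Suc n)) choose 3) * (k + 4) ^ 3" by simp
  moreover have "q - 1 = k + 4" by (simp add: k)
  ultimately show ?thesis unfolding n by (simp only: k)
qed

text \<open>For q = 4 the counting bound just fails. The thirteen points then form a coset of the
  thirteenth roots of unity, and the dependency is a word of weight 6 of the quadratic residue
  code of length 13 over the field with 4 elements; w1 and w2 are the two Gauss periods.\<close>

lemma residue_code_word:
  fixes x :: "'b::comm_ring_1"
  assumes "x ^ 13 = 1" "(2::'b) = 0"
  defines "w1 \<equiv> x + x^3 + x^4 + x^9 + x^10 + x^12" and "w2 \<equiv> x^2 + x^5 + x^6 + x^7 + x^8 + x^11"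
  shows "1 + x + w2 * x^2 + w1 * x^4 + w2 * x^5 + w1 * x^8 = 0"
proof -
  \<comment> \<open>An identity of integer polynomials: modulo 2 the word is divisible by x^13 -
    1.\<close>
  have "1 + x + w2 * x^2 + w1 * x^4 + w2 * x^5 + w1 * x^8 =
    2 * (2 + x + x^3 + x^4 + x^5 + 2 * x^7 + x^8 + x^9 + x^10 + x^11 + x^12)
    + (x^13 - 1) * (3 + x + 2 * x^3 + x^4 + x^5 + x^7)"
    unfolding w1_def w2_def by (simp add: algebra_simps eval_nat_numeral)
  then show ?thesis using assms by simp
qed

section \<open>Relations between six points of the zero set\<close>

context twisted_norm_form begin

text \<open>By pigeonhole two different combinations of three points coincide. Their difference is a
  relation between at most six points, padded with zeros to exactly six.\<close>

lemma dependent_6_packing: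
  assumes "5 \<le> q"
  shows "\<exists>I c. I \<subseteq> Zs \<and> card I = 6 \<and> (\<forall>i\<in>I. c i \<in> Fq q) \<and> Lc I pt c = 0 \<and> (\<exists>i\<in>I. c i \<noteq> 0)"
proof -
  define S where "S = (SIGMA J:{J. J \<subseteq> Zs \<and> card J = 3}. J \<rightarrow>\<^sub>E (Fq q - {0::'a}))"
  have cS: "card S = (card Zs choose 3) * (q - 1) ^ 3"
  proof -
    have "card (J \<rightarrow>\<^sub>E (Fq q - {0::'a})) = (q - 1) ^ 3" if "card J = 3" for J :: "'a option set"
      using that by (simp add: card_PiE card_Diff_singleton card_Fq)
    then have "card S = (\<Sum>J | J \<subseteq> Zs \<and> card J = 3. (q - 1) ^ 3)"
      unfolding S_def by (subst card_SigmaI) (auto intro!: finite_PiE)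
    then show ?thesis using n_subsets[of Zs 3] by simp
  qed
  define \<Phi> where "\<Phi> = (\<lambda>(J, c). Lc J pt c)"
  have "\<Phi> ` S \<subseteq> H"
    unfolding \<Phi>_def S_def using pt_in_H by (auto intro!: Lc_in_subspace[OF fsubspace_H])
  then have "card (\<Phi> ` S) \<le> q ^ 7" using card_mono[of H "\<Phi> ` S"] card_H_le by simp
  also have "\<dots> < card S" unfolding cS card_Zs by (rule packing_bound[OF assms])
  finally have "\<not> inj_on \<Phi> S" using card_image by fastforce
  then obtain J c J' c' where JJ: "(J, c) \<in> S" "(J', c') \<in> S" "(J, c) \<noteq> (J', c')" "Lc J pt c = Lc J' pt c'"
    unfolding inj_on_def \<Phi>_def by auto
  have J: "J \<subseteq> Zs" "card J = 3" "\<And>i. i \<in> J \<Longrightarrow> c i \<in> Fq q \<and> c i \<noteq> 0" "c \<in> J \<rightarrow>\<^sub>E Fq q"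
    and J': "J' \<subseteq> Zs" "card J' = 3" "\<And>i. i \<in> J' \<Longrightarrow> c' i \<in> Fq q \<and> c' i \<noteq> 0" "c' \<in> J' \<rightarrow>\<^sub>E Fq q"
    using JJ unfolding S_def by (auto simp: PiE_iff)
  define d where "d i = (if i \<in> J then c i else 0) - (if i \<in> J' then c' i else 0)" for i
  have "card (J \<union> J') \<le> 6" using card_Un_le[of J J'] J J' by simp
  moreover have "4 * 3 \<le> q * (q - 1)" using q_ge by (intro mult_le_mono) auto
  then have "6 \<le> card Zs" unfolding card_Zs by (simp add: power2_eq_square algebra_simps)
  ultimately obtain I where I: "J \<union> J' \<subseteq> I" "I \<subseteq> Zs" "card I = 6"
    using exists_subset_between[of "J \<union> J'" 6 Zs] J J' by auto
  have ext: "Lc I pt (\<lambda>i. if i \<in> A then e i else 0) = Lc A pt e" if "A \<subseteq> I" for A e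
    unfolding Lc_def using that by (intro sum.mono_neutral_cong_right) auto
  have "Lc I pt d = Lc J pt c - Lc J' pt c'"
    unfolding d_def Lc_diff[symmetric] using ext I by simp
  then have d0: "Lc I pt d = 0" using JJ by simp
  \<comment> \<open>If d vanished, the supports J and J' would agree, because all coefficients on
    them are nonzero, and then so would the coefficients.\<close>
  have "\<exists>i\<in>I. d i \<noteq> 0"
  proof (rule ccontr)
    assume "\<not> ?thesis"
    then have z: "d i = 0" if "i \<in> J \<union> J'" for i using I that by blast
    have "J = J'"
    proof (rule Set.set_eqI)
      fix i show "i \<in> J \<longleftrightarrow> i \<in> J'" using z[of i] J(3)[of i] J'(3)[of i] by (auto simp: d_def split: if_splits)
    qed
    moreover have "c i = c' i" if "i \<in> J" for i using z[of i] that \<open>J = J'\<close> by (simp add: d_def)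
    then have "c = c'" using J(4) J'(4) \<open>J = J'\<close> by (intro PiE_ext) auto
    ultimately show False using JJ(3) by simp
  qed
  moreover have "\<forall>i\<in>I. d i \<in> Fq q" using J(3) J'(3) by (auto simp: d_def intro!: Fq_diff Fq_minus)
  ultimately show ?thesis using I d0 by blast
qed

text \<open>The points with u = y x^e for e in \<open>E\<close> receive the coefficients of the code
  word divided by g * m. On them every monomial of \<open>ev_corners\<close> is a constant times
  (x^j)^e, with j = 0 or j a quadratic residue modulo 13, and the word polynomial \<open>P\<close>
  vanishes at all these x^j.\<close>

lemma dependent_6_four:
  assumes q4: "q = 4"
  shows "\<exists>I c. I \<subseteq> Zs \<and> card I = 6 \<and> (\<forall>i\<in>I. c i \<in> Fq q) \<and> Lc I pt c = 0 \<and> (\<exists>i\<in>I. c i \<noteq> 0)"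
proof -
  have two: "(2 :: 'a alg_closure) = 0"
  proof -
    obtain k where k: "prime CHAR('a)" "q = CHAR('a) ^ k" using CHAR_power by blast
    then have "CHAR('a) dvd 2 ^ 2"
      using q4 by (cases k) (auto simp: dvd_def)
    then have "CHAR('a) = 2" using k(1) prime_dvd_power primes_dvd_imp_eq two_is_prime_nat by blast
    then have "of_nat 2 = (0 :: 'a alg_closure)" using of_nat_CHAR[where 'a = "'a alg_closure"] by simp
    then show ?thesis by simp
  qed
  have n13: "q\<^sup>2 - q + 1 = 13" by (simp add: q4)
  then have c13: "card Zs = 13" using card_Zs by simp
  then have "\<not> Zs \<subseteq> {s}" for s using card_mono[of "{s}" Zs] by auto
  then obtain s0 s1 where s01: "s0 \<in> Zs" "s1 \<in> Zs" "s0 \<noteq> s1" by blast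
  \<comment> \<open>The quotient of two distinct roots of u^13 = \<kappa> is a nontrivial thirteenth
    root of unity.\<close>
  define x where "x = u s1 / u s0"
  define y where "y = u s0"
  have Zs13: "s \<in> Zs \<longleftrightarrow> u s ^ 13 = \<kappa>" for s using Zs_iff_power unfolding n13 .
  have y: "y ^ 13 = \<kappa>" "y \<noteq> 0" using s01 Zs13 by (simp_all add: y_def)
  have "u s1 ^ 13 = \<kappa>" using s01 Zs13 by simp
  then have x13: "x ^ 13 = 1" unfolding x_def using y by (simp add: power_divide y_def)
  have x1: "x \<noteq> 1" using s01 inj_u[of s1 s0] by (auto simp: x_def)
  have x0: "x \<noteq> 0" using x13 by auto
  have red: "x ^ n = x ^ (n mod 13)" for n
  proof -
    have "x ^ n = x ^ (13 * (n div 13) + n mod 13)" by simp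
    then show ?thesis unfolding power_add power_mult x13 by simp
  qed
  \<comment> \<open>Here e is an inverse of d modulo 13, so x^d = 1 would give x = 1.\<close>
  have xneq: "x ^ d \<noteq> 1" if "d * e mod 13 = 1" for d e
    using red[of "d * e"] that x1 by (auto simp: power_mult)
  define E :: "nat set" where "E = {0, 1, 2, 4, 5, 8}"
  have xinj: "inj_on (\<lambda>e. x ^ e) E"
  proof (rule linorder_inj_onI)
    fix e f :: nat assume ef: "e < f" "e \<in> E" "f \<in> E"
    have "f - e \<in> {1, 2, 3, 4, 5, 6, 7, 8}" using ef by (auto simp: E_def)
    then have "x ^ (f - e) \<noteq> 1"
      using xneq[of 1 1] xneq[of 2 7] xneq[of 3 9] xneq[of 4 10] xneq[of 5 8] xneq[of 6 11] xneq[of 7 2] xneq[of 8 5]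
      by (elim insertE emptyE) simp_all
    moreover have "x ^ f = x ^ e * x ^ (f - e)" using ef by (simp flip: power_add)
    ultimately show "x ^ e \<noteq> x ^ f" using x0 by simp
  qed auto
  have "y * x ^ e \<in> u ` Zs" for e
  proof -
    have "(x ^ e) ^ 13 = (x ^ 13) ^ e" unfolding power_mult[symmetric] by (simp only: mult.commute)
    then have "(x ^ e) ^ 13 = 1" using x13 by simp
    then show ?thesis unfolding u_image_Zs n13 using y by (simp add: power_mult_distrib)
  qed
  then have "\<exists>s\<in>Zs. u s = y * x ^ e" for e by (metis imageE)
  then obtain r where r: "\<And>e. r e \<in> Zs" "\<And>e. u (r e) = y * x ^ e" by metis
  have rinj: "inj_on r E"
    using xinj r(2) y(2) unfolding inj_on_def by (metis mult_left_cancel)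
  define w1 where "w1 = x + x^3 + x^4 + x^9 + x^10 + x^12"
  define w2 where "w2 = x^2 + x^5 + x^6 + x^7 + x^8 + x^11"
  \<comment> \<open>The coefficients of \<open>residue_code_word\<close> at the exponents in
    \<open>E\<close>. They are fixed by the Frobenius map, which sends x to x^4 and permutes the
    terms of each Gauss period, because 4 is a quadratic residue modulo 13.\<close>
  define w where "w e = (if e \<le> 1 then 1 else if e = 2 \<or> e = 5 then w2 else w1)" for e :: nat
  have sx: "\<sigma> x = x ^ 4" by (simp add: frob_def q4)
  have sw: "\<sigma> (w e) = w e" for e
  proof -
    have "\<sigma> w1 = w1" unfolding w1_def
      by (simp add: sx flip: power_mult) (simp add: red[of 12] red[of 16] red[of 36] red[of 40] red[of 48])
    moreover have "\<sigma> w2 = w2" unfolding w2_def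
      by (simp add: sx flip: power_mult) (simp add: red[of 20] red[of 24] red[of 28] red[of 32] red[of 44])
    ultimately show ?thesis by (simp add: w_def)
  qed
  define P where "P z = (\<Sum>e\<in>E. w e * z ^ e)" for z
  have P1: "P 1 = 0"
  proof -
    have "P 1 = 2 * (1 + w1 + w2)" by (simp add: P_def E_def w_def algebra_simps)
    then show ?thesis using two by simp
  qed
  have Px: "P x = 0"
    using residue_code_word[OF x13 two] unfolding P_def E_def w_def w1_def w2_def by (simp add: algebra_simps)
  \<comment> \<open>As the coefficients of \<open>P\<close> are fixed, the Frobenius map carries its
    zero x through x^4, x^3, x^12, x^9 and x^10: the exponents are the powers of 4 modulo 13, which
    are all the quadratic residues.\<close>
  have sP: "\<sigma> (P z) = P (\<sigma> z)" for z by (simp add: P_def frob_sum_ac sw)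
  have P4: "P (x^4) = 0" using sP[of x] Px by (simp add: sx)
  have P3: "P (x^3) = 0" using sP[of "x^4"] P4 red[of 16] by (simp add: sx flip: power_mult)
  have P12: "P (x^12) = 0" using sP[of "x^3"] P3 by (simp add: sx flip: power_mult)
  have P9: "P (x^9) = 0" using sP[of "x^12"] P12 red[of 48] by (simp add: sx flip: power_mult)
  have P10: "P (x^10) = 0" using sP[of "x^9"] P9 red[of 36] by (simp add: sx flip: power_mult)
  \<comment> \<open>Division by \<open>m\<close> cancels the common factor of
    \<open>ev_corners\<close>. The factor g makes the quotient descend to \<open>Fq\<close>, since g
    * m is fixed by the Frobenius map on the zero set.\<close>
  define c where "c s = of_ac (w (inv_into E r s) / (g * m s))" for s
  have fixed: "\<sigma> (w e / (g * m (r e))) = w e / (g * m (r e))" for e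
    using r(1)[of e] unfolding Zs_iff by (simp add: sw)
  have toc: "to_ac (c (r e)) = w e / (g * m (r e))" if "e \<in> E" for e
  proof -
    have "w e / (g * m (r e)) \<in> range (to_ac :: 'a \<Rightarrow> _)" using fixed frob_cubed_ac_iff by metis
    then show ?thesis unfolding c_def using rinj that by (simp add: to_ac_of_ac)
  qed
  have cFq: "c (r e) \<in> Fq q" if "e \<in> E" for e
  proof -
    have "to_ac (\<sigma> (c (r e))) = to_ac (c (r e))" using fixed[of e] by (simp add: toc[OF that])
    then show ?thesis unfolding Fq_iff by (simp only: to_ac_eq_iff)
  qed
  have ev0: "ev e (Lc (r ` E) pt c) = 0" for e
  proof -
    let ?C = "corner e" and ?z = "\<sigma> y"
    have ix: "inverse x = x ^ 12" using x13 x0 by (simp add: field_simps flip: power_Suc)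
    have i4: "inverse (x ^ 4) = x ^ 9" using x13 x0 by (simp add: field_simps flip: power_add)
    have b: "x ^ 4 * x ^ 12 = x ^ 3" "x * x ^ 9 = x ^ 10" using red[of 16] by (simp_all flip: power_add power_Suc)
    have U: "inverse (u (r i)) = inverse y * (x ^ 12) ^ i" "\<sigma> (u (r i)) = ?z * (x ^ 4) ^ i"
      "inverse (\<sigma> (u (r i))) = inverse ?z * (x ^ 9) ^ i"
      "\<sigma> (u (r i)) * inverse (u (r i)) = ?z * inverse y * (x ^ 3) ^ i"
      "u (r i) * inverse (\<sigma> (u (r i))) = y * inverse ?z * (x ^ 10) ^ i" for i
    proof -
      show 1: "inverse (u (r i)) = inverse y * (x ^ 12) ^ i" by (simp add: r power_inverse[symmetric] flip: ix)
      show 2: "\<sigma> (u (r i)) = ?z * (x ^ 4) ^ i" by (simp add: r sx)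
      show 3: "inverse (\<sigma> (u (r i))) = inverse ?z * (x ^ 9) ^ i" unfolding 2 by (simp add: power_inverse[symmetric] flip: i4)
      show "\<sigma> (u (r i)) * inverse (u (r i)) = ?z * inverse y * (x ^ 3) ^ i"
        unfolding 1 2 b(1)[symmetric] by (simp only: power_mult_distrib mult_ac)
      show "u (r i) * inverse (\<sigma> (u (r i))) = y * inverse ?z * (x ^ 10) ^ i"
        unfolding 3 unfolding r b(2)[symmetric] by (simp only: power_mult_distrib mult_ac)
    qed
    have summand: "to_ac (c (r i)) * (D * ev e (pt (r i))) = inverse g * (
        ?C th th th * inverse ?z * (w i * (x ^ 9) ^ i) - \<kappa> * ?C th th th' * inverse y * (w i * (x ^ 12) ^ i)
      - ?C th th' th * (w i * 1 ^ i) + \<kappa> * ?C th th' th' * (?z * inverse y) * (w i * (x ^ 3) ^ i)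
      - ?C th' th th * (y * inverse ?z) * (w i * (x ^ 10) ^ i) + \<kappa> * ?C th' th th' * (w i * 1 ^ i)
      + ?C th' th' th * y * (w i * x ^ i) - \<kappa> * ?C th' th' th' * ?z * (w i * (x ^ 4) ^ i))" if "i \<in> E" for i
    proof -
      have *: "w i / (g * m (r i)) * (m (r i) * Y) = inverse g * (w i * Y)" for Y
        by (simp add: divide_inverse)
      show ?thesis unfolding ev_corners[OF r(1)] toc[OF that] * unfolding U(4,5) unfolding U(3)
        unfolding U(1,2) unfolding r(2)
        by (simp only: distrib_left right_diff_distrib power_one mult_1_left mult_1_right mult_ac)
    qed
    have "D * ev e (Lc (r ` E) pt c) = (\<Sum>i\<in>E. to_ac (c (r i)) * (D * ev e (pt (r i))))"
      unfolding ev_Lc by (subst sum.reindex[OF rinj]) (simp add: sum_distrib_left mult.left_commute)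
    also have "\<dots> = inverse g * (?C th th th * inverse ?z * P (x ^ 9) - \<kappa> * ?C th th th' * inverse y * P (x ^ 12)
      - ?C th th' th * P 1 + \<kappa> * ?C th th' th' * (?z * inverse y) * P (x ^ 3)
      - ?C th' th th * (y * inverse ?z) * P (x ^ 10) + \<kappa> * ?C th' th th' * P 1
      + ?C th' th' th * y * P x - \<kappa> * ?C th' th' th' * ?z * P (x ^ 4))"
      unfolding P_def sum_distrib_left sum.distrib[symmetric] sum_subtractf[symmetric]
      by (intro sum.cong refl summand)
    also have "\<dots> = 0" by (simp add: P1 Px P4 P3 P12 P9 P10)
    finally show ?thesis using D_nz by simp
  qed
  \<comment> \<open>Coordinates are special functionals, so the vector itself vanishes.\<close>
  have "Lc (r ` E) pt c $ i = 0" for i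
  proof -
    have "ev (axis i 1) (Lc (r ` E) pt c) = to_ac (Lc (r ` E) pt c $ i)"
      unfolding ev_def axis_def by (simp add: if_distrib[of "\<lambda>a. a * _"] cong: if_cong)
    then show ?thesis using ev0 by simp
  qed
  then have Lc0: "Lc (r ` E) pt c = 0" by (simp add: vec_eq_iff)
  have "c (r 0) \<noteq> 0"
  proof -
    have "to_ac (c (r 0)) \<noteq> 0" using toc[of 0] g_nz by (simp add: E_def w_def)
    then show ?thesis by auto
  qed
  moreover have "0 \<in> E" by (simp add: E_def)
  moreover have "card (r ` E) = 6" unfolding card_image[OF rinj] by (simp add: E_def)
  ultimately show ?thesis using Lc0 cFq r(1) by (intro exI[of _ "r ` E"] exI[of _ c]) auto
qed

lemma dependent_6:
  "\<exists>I c. I \<subseteq> Zs \<and> card I = 6 \<and> (\<forall>i\<in>I. c i \<in> Fq q) \<and> Lc I pt c = 0 \<and> (\<exists>i\<in>I. c i \<noteq> 0)"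
  using dependent_6_packing dependent_6_four q_ge by (cases "q = 4") auto

section \<open>The three conditions of a (4,3)-set\<close>

lemma H_5_general: "rs_set q H 4 3 {P \<in> O1 q. P \<subseteq> H}"
  unfolding rs_set_def
proof (intro conjI allI impI)
  have count: "card {P \<in> {P \<in> O1 q. P \<subseteq> H}. P \<subseteq> W} = card {s. pt s \<in> W}"
    if "fsubspace q W" "W \<subseteq> H" for W
  proof -
    have "{P \<in> {P \<in> O1 q. P \<subseteq> H}. P \<subseteq> W} = {P \<in> O1 q. P \<subseteq> W}" using that(2) by blast
    then show ?thesis using card_points_in_subspace[OF that(1)] by simp
  qed
  \<comment> \<open>Five points of the zero set in W would be independent and would need q^5
    vectors, but projective dimension 3 leaves only q^4.\<close>
  show "card {P \<in> {P \<in> O1 q. P \<subseteq> H}. P \<subseteq> W} \<le> 4"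
    if W: "fsubspace q W \<and> W \<subseteq> H \<and> fdim q W = 3 + 1" for W
  proof (rule ccontr)
    assume "\<not> ?thesis"
    then have "5 \<le> card {s. pt s \<in> W}" using count W by simp
    then obtain I where I: "I \<subseteq> {s. pt s \<in> W}" "card I = 5" using obtain_subset_with_card_n by metis
    then have "indep I pt" using W pt_in_H by (intro indep_5) auto
    then have "q ^ 5 \<le> card W" using card_fsubspace_ge[of I pt W] I W by auto
    also have "\<dots> = q ^ 4" using card_fsubspace[of W] W by simp
    finally show False using q_ge by (simp add: power_increasing_iff)
  qed
  show "fspan q (\<Union> {P \<in> O1 q. P \<subseteq> H}) = H"
  proof
    show "fspan q (\<Union> {P \<in> O1 q. P \<subseteq> H}) \<subseteq> H" by (intro fspan_least fsubspace_H) blast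
    have "pt s \<in> fspan q {pt s}" for s using fspan_superset[of "{pt s}"] by simp
    then have "pt ` Zs \<subseteq> \<Union> {P \<in> O1 q. P \<subseteq> H}"
      unfolding points_in_subspace[OF fsubspace_H] pt_in_H by blast
    then have "fspan q (pt ` Zs) \<subseteq> fspan q (\<Union> {P \<in> O1 q. P \<subseteq> H})" by (rule fspan_mono)
    then show "H \<subseteq> fspan q (\<Union> {P \<in> O1 q. P \<subseteq> H})" unfolding fspan_Zs .
  qed
  show "\<exists>W. fsubspace q W \<and> W \<subseteq> H \<and> fdim q W = 3 + 2 \<and> 4 + 2 \<le> card {P \<in> {P \<in> O1 q. P \<subseteq> H}. P \<subseteq> W}"
  proof -
    obtain I c j where I: "I \<subseteq> Zs" "card I = 6" "\<forall>i\<in>I. c i \<in> Fq q" "Lc I pt c = 0" "j \<in> I" "c j \<noteq> 0"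
      using dependent_6 by blast
    \<comment> \<open>In this relation pt j depends on the other five points, which are independent.
      So the six points span a space of vector dimension exactly 5, that is, projective dimension
      4.\<close>
    let ?W = "fspan q (pt ` I)"
    have W: "fsubspace q ?W" by (rule fsubspace_fspan)
    have WH: "?W \<subseteq> H" using I(1) pt_in_H by (intro fspan_least fsubspace_H) auto
    have "pt j \<in> fspan q (pt ` (I - {j}))" using dependent_in_span[of I pt c j] I by simp
    then have "pt ` I \<subseteq> fspan q (pt ` (I - {j}))" using fspan_superset[of "pt ` (I - {j})"] by auto
    then have "?W \<subseteq> fspan q (pt ` (I - {j}))" using fspan_least[OF fsubspace_fspan] by blast
    moreover have "fspan q (pt ` (I - {j})) \<subseteq> ?W" by (intro fspan_mono) auto
    ultimately have "?W = fspan q (pt ` (I - {j}))" by blast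
    moreover have "card (fspan q (pt ` (I - {j}))) = q ^ 5"
      using card_fspan_indep[of "I - {j}" pt] indep_le_5[of "I - {j}"] I by auto
    ultimately have "q ^ fdim q ?W = q ^ 5" using card_fsubspace[OF W] by simp
    then have "fdim q ?W = 5" using q_ge by (simp add: power_inject_exp)
    moreover have "I \<subseteq> {s. pt s \<in> ?W}" using fspan_superset[of "pt ` I"] by auto
    then have "6 \<le> card {s. pt s \<in> ?W}" using card_mono[of "{s. pt s \<in> ?W}" I] I(2) by simp
    ultimately show ?thesis using W WH count[OF W WH] by (intro exI[of _ ?W]) simp
  qed
qed

end

theorem mainTheorem9:
  fixes q :: nat and H1 :: "('a::{field,finite} ^ 8) set"
  assumes "\<exists>p k. prime p \<and> k > 0 \<and> q = p ^ k"
    and "CARD('a) = q ^ 3"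
    and "q \<ge> 4"
    and "fsubspace q H1" and "H1 \<subseteq> U1 q" and "fdim q H1 = 7"
    and "card {P \<in> O1 q. P \<subseteq> H1} = q^2 - q + 1"
  shows "k_general q H1 5 {P \<in> O1 q. P \<subseteq> H1}"
proof -
  interpret cubic_field q "TYPE('a)" using assms(1-3) by unfold_locales
  obtain v where v: "v \<in> U1 q" "v \<noteq> 0" "H1 = {w \<in> U1 q. dot v w = 0}"
    using hyperplane_equation[OF assms(4-6)] by blast
  obtain a b c d where P: "v = Pvec q a b c d" "a \<in> Fq q" "d \<in> Fq q" using v(1) by (auto simp: U1_def)
  have card: "card {s. dot v (pt s) = 0} = q\<^sup>2 - q + 1"
    using card_points_in_subspace[OF assms(4)] assms(7) by (simp add: v(3) pt_in_U1)
  have "4 * 3 \<le> q * (q - 1)" using assms(3) by (intro mult_le_mono) auto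
  \<comment> \<open>The count lies strictly between 1 and q^2 + 1, which excludes all counts of
    degenerate forms.\<close>
  then have "q\<^sup>2 - q + 1 \<notin> {1, q\<^sup>2 + 1, q\<^sup>2 + q + 1}"
    using assms(3) by (simp add: power2_eq_square algebra_simps, intro conjI; linarith)
  then have nondeg: "card {s. form a b c d s = 0} \<notin> {1, q\<^sup>2 + 1, q\<^sup>2 + q + 1}"
    using card by (simp add: form_def P(1))
  have nz: "Pvec q a b c d \<noteq> 0" using v P by simp
  \<comment> \<open>Hence the discriminant has a zero neither in the field nor at infinity, as the
    splitting requires.\<close>
  have noroot: "Qf a b c d t \<noteq> 0" for t using card_zeros_degenerate[OF P(2,3) _ nz] nondeg by blast
  have noinf: "d * b \<noteq> \<sigma> c * \<sigma> (\<sigma> c)"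
    using card_zeros_degenerate_at_infinity[OF P(2,3) _ nz] nondeg by blast
  obtain th th' g where th: "th' = \<sigma> (\<sigma> (\<sigma> th))" "th = \<sigma> (\<sigma> (\<sigma> th'))" "th \<noteq> th'" "\<sigma> (\<sigma> g) = g"
    "\<And>x0 x1 y0 y1 w0 w1. (th - th') * \<sigma> (th - th') * \<sigma> (\<sigma> (th - th')) * tri (up (Pvec q a b c d)) x0 x1 y0 y1 w0 w1 =
       \<sigma> g * ((x1 - th * x0) * (y1 - \<sigma> th' * y0) * (w1 - \<sigma> (\<sigma> th) * w0))
       - g * ((x1 - th' * x0) * (y1 - \<sigma> th * y0) * (w1 - \<sigma> (\<sigma> th') * w0))"
    by (rule irreducible_form_split[OF P(2,3) noroot noinf], rule that)
  interpret twisted_norm_form q "TYPE('a)" v th th' g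
    using v(1,2) th(3,4) th(1,2)[symmetric] th(5)[folded P(1)] card by unfold_locales
  have "H1 = H" by (simp add: v(3) H_def)
  then show ?thesis using H_5_general by (simp add: k_general_def)
qed

end
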